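(* Let $\lambda\in\mathbb{R}\setminus[-1,1]$, $m\in\mathbb{N}$, let $a_1,\dots,a_m\in\mathbb{C}\setminus\{0\}$ satisfy $a_1+\cdots+a_m=|\lambda|$, and let $\tau_1<\cdots<\tau_m$ be real numbers. Let $f$ be the unique compactly supported distribution on $\mathbb{R}$ satisfying $f(x)=\sum_{j=1}^m a_jf(\lambda x-\tau_j)$ and $\int f(x)\,dx=1$, let $\widehat f(y)=\int_{-\infty}^{\infty}f(x)e^{2\pi i xy}\,dx$ be its Fourier transform, and let $A(y)=|\lambda|^{-1}\sum_{j=1}^m a_je^{2\pi i\tau_jy}$. Define $\rho(f)=-\ln M(A)/\ln|\lambda|$, where $M(A)$ is the Mahler measure of $A$. Then $$\lim_{L\to\infty}\frac{1}{2L\ln L}\int_{-L}^{L}\ln|\widehat f(y)|\,dy=-\rho(f).$$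
   Context: Integrals against the distribution $f$ are understood as distributional pairings; in particular $\int f(x)\,dx=1$ means $\widehat f(0)=1$. The Mahler measure of a nonzero (Laurent) polynomial $P(z_1,\dots,z_d)$ is $$M(P)=\exp\int_0^1\cdots\int_0^1\ln|P(e^{2\pi i t_1},\dots,e^{2\pi i t_d})|\,dt_1\cdots dt_d.$$ Let $d$ be the maximal number of elements of $\{\tau_1,\dots,\tau_m\}$ that are linearly independent over $\mathbb{Q}$. There exist $r_1,\dots,r_d\in\mathbb{R}$, linearly independent over $\mathbb{Q}$, and a Laurent polynomial $P(z_1,\dots,z_d)$ such that $A(y)=P(e^{2\pi i r_1y},\dots,e^{2\pi i r_dy})$ for all $y\in\mathbb{R}$. The Mahler measure of $A$ is defined by $M(A)=M(P)$; it does not depend on the choice of $P$ and the $r_j$, since $\ln M(A)=\lim_{L\to\infty}\frac1{2L}\int_{-L}^{L}\ln|A(y)|\,dy$. If $d=0$ (that is, $m=1$ and $\tau_1=0$) then $A\equiv1$ and $M(A)=1$. *)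

theory Defs
  imports "HOL-Analysis.Analysis" "HOL-Library.Poly_Mapping"
begin

section \<open>Distributions on the real line\<close>

definition nderiv :: "nat \<Rightarrow> (real \<Rightarrow> complex) \<Rightarrow> real \<Rightarrow> complex" where
  "nderiv n = (\<lambda>g x. vector_derivative g (at x)) ^^ n"

definition smooth_fun :: "(real \<Rightarrow> complex) \<Rightarrow> bool" where
  "smooth_fun \<phi> \<longleftrightarrow> (\<forall>n x. nderiv n \<phi> differentiable (at x))"

definition fun_supp :: "(real \<Rightarrow> complex) \<Rightarrow> real set" where
  "fun_supp \<phi> = closure {x. \<phi> x \<noteq> 0}"

definition test_fun :: "(real \<Rightarrow> complex) \<Rightarrow> bool" where
  "test_fun \<phi> \<longleftrightarrow> smooth_fun \<phi> \<and> compact (fun_supp \<phi>)"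

text \<open>
  A distribution is a total function in HOL, but only its values on test functions are
  meaningful: every notion below inspects it on test functions only.
\<close>

definition distribution :: "((real \<Rightarrow> complex) \<Rightarrow> complex) \<Rightarrow> bool" where
  "distribution u \<longleftrightarrow>
     (\<forall>\<phi> \<psi>. test_fun \<phi> \<longrightarrow> test_fun \<psi> \<longrightarrow> u (\<lambda>x. \<phi> x + \<psi> x) = u \<phi> + u \<psi>) \<and>
     (\<forall>c \<phi>. test_fun \<phi> \<longrightarrow> u (\<lambda>x. c * \<phi> x) = c * u \<phi>) \<and>
     (\<forall>K. compact K \<longrightarrow>
        (\<exists>C::real. \<exists>N::nat. \<forall>\<phi>. test_fun \<phi> \<longrightarrow> fun_supp \<phi> \<subseteq> K \<longrightarrow>
           cmod (u \<phi>) \<le> C * (\<Sum>k\<le>N. SUP x. cmod (nderiv k \<phi> x))))"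

definition dist_supp :: "((real \<Rightarrow> complex) \<Rightarrow> complex) \<Rightarrow> real set" where
  "dist_supp u = - \<Union>{U. open U \<and> (\<forall>\<phi>. test_fun \<phi> \<longrightarrow> fun_supp \<phi> \<subseteq> U \<longrightarrow> u \<phi> = 0)}"

definition compactly_supported_distribution :: "((real \<Rightarrow> complex) \<Rightarrow> complex) \<Rightarrow> bool" where
  "compactly_supported_distribution u \<longleftrightarrow> distribution u \<and> compact (dist_supp u)"

text \<open>
  The pairing of a compactly supported distribution with an arbitrary smooth function
  \<open>\<psi>\<close> is \<open>u (\<eta> \<psi>)\<close>, for a test function \<open>\<eta>\<close> equal to 1 near the support of \<open>u\<close>; the value
  does not depend on the cutoff.
\<close>

definition cutoff :: "((real \<Rightarrow> complex) \<Rightarrow> complex) \<Rightarrow> (real \<Rightarrow> complex) \<Rightarrow> bool" where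
  "cutoff u \<eta> \<longleftrightarrow> test_fun \<eta> \<and> (\<exists>U. open U \<and> dist_supp u \<subseteq> U \<and> (\<forall>x\<in>U. \<eta> x = 1))"

definition dist_pairing :: "((real \<Rightarrow> complex) \<Rightarrow> complex) \<Rightarrow> (real \<Rightarrow> complex) \<Rightarrow> complex" where
  "dist_pairing u \<psi> = u (\<lambda>x. (SOME \<eta>. cutoff u \<eta>) x * \<psi> x)"

text \<open>The Fourier transform is normalised as \<open>\<integral> u(x) e\<^bsup>2\<pi>ixy\<^esup> dx\<close>.\<close>

definition dist_fourier :: "((real \<Rightarrow> complex) \<Rightarrow> complex) \<Rightarrow> real \<Rightarrow> complex" where
  "dist_fourier u y = dist_pairing u (\<lambda>x. cis (2 * pi * x * y))"

text \<open>
  The distribution \<open>u(\<lambda>x - \<tau>)\<close> for \<open>\<lambda> \<noteq> 0\<close>: the change of variables \<open>t = \<lambda>x - \<tau>\<close> turns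
  \<open>\<integral> u(\<lambda>x - \<tau>) \<phi>(x) dx\<close> into \<open>\<bar>\<lambda>\<bar>\<^sup>-\<^sup>1 \<integral> u(t) \<phi>((t + \<tau>)/\<lambda>) dt\<close>.
\<close>

definition dist_affine ::
  "real \<Rightarrow> real \<Rightarrow> ((real \<Rightarrow> complex) \<Rightarrow> complex) \<Rightarrow> (real \<Rightarrow> complex) \<Rightarrow> complex" where
  "dist_affine lam t u \<phi> = u (\<lambda>x. \<phi> ((x + t) / lam)) / of_real \<bar>lam\<bar>"

definition refinable ::
  "real \<Rightarrow> nat \<Rightarrow> (nat \<Rightarrow> complex) \<Rightarrow> (nat \<Rightarrow> real) \<Rightarrow> ((real \<Rightarrow> complex) \<Rightarrow> complex) \<Rightarrow> bool" where
  "refinable lam m a \<tau> f \<longleftrightarrow>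
     (\<forall>\<phi>. test_fun \<phi> \<longrightarrow> f \<phi> = (\<Sum>j=1..m. a j * dist_affine lam (\<tau> j) f \<phi>))"

section \<open>Mahler measure\<close>

text \<open>
  A Laurent polynomial maps monomials (finitely supported exponent vectors, the variables
  being indexed from 0) to coefficients.
\<close>

type_synonym laurent_mpoly = "(nat \<Rightarrow>\<^sub>0 int) \<Rightarrow>\<^sub>0 complex"

definition in_vars :: "nat \<Rightarrow> laurent_mpoly \<Rightarrow> bool" where
  "in_vars d P \<longleftrightarrow> (\<forall>k\<in>Poly_Mapping.keys P. Poly_Mapping.keys k \<subseteq> {..<d})"

definition laurent_eval :: "laurent_mpoly \<Rightarrow> (nat \<Rightarrow> complex) \<Rightarrow> complex" where
  "laurent_eval P z =
     (\<Sum>k\<in>Poly_Mapping.keys P. Poly_Mapping.lookup P k *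
        (\<Prod>j\<in>Poly_Mapping.keys k. z j powi Poly_Mapping.lookup k j))"

definition mahler_measure :: "nat \<Rightarrow> laurent_mpoly \<Rightarrow> real" where
  "mahler_measure d P = exp
     (LINT t:({..<d} \<rightarrow>\<^sub>E {0..1}) | (\<Pi>\<^sub>M j\<in>{..<d}. lborel).
        ln (cmod (laurent_eval P (\<lambda>j. cis (2 * pi * t j)))))"

abbreviation rat_independent :: "real set \<Rightarrow> bool" where
  "rat_independent S \<equiv> module.independent (\<lambda>(q::rat) (x::real). of_rat q * x) S"

definition rat_rank :: "real set \<Rightarrow> nat" where
  "rat_rank T = Max {card S | S. S \<subseteq> T \<and> rat_independent S}"

definition laurent_rep :: "nat \<Rightarrow> (real \<Rightarrow> complex) \<Rightarrow> (nat \<Rightarrow> real) \<Rightarrow> laurent_mpoly \<Rightarrow> bool" where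
  "laurent_rep d A r P \<longleftrightarrow>
     inj_on r {..<d} \<and> rat_independent (r ` {..<d}) \<and> in_vars d P \<and>
     (\<forall>y. A y = laurent_eval P (\<lambda>j. cis (2 * pi * r j * y)))"

text \<open>
  The Mahler measure of an exponential sum \<open>A\<close> with finite frequency set \<open>T\<close>; it does not
  depend on the chosen representation.
\<close>

definition exp_sum_mahler :: "real set \<Rightarrow> (real \<Rightarrow> complex) \<Rightarrow> real" where
  "exp_sum_mahler T A =
     (let d = rat_rank T in mahler_measure d (SOME P. \<exists>r. laurent_rep d A r P))"

definition mask :: "real \<Rightarrow> nat \<Rightarrow> (nat \<Rightarrow> complex) \<Rightarrow> (nat \<Rightarrow> real) \<Rightarrow> real \<Rightarrow> complex" where
  "mask lam m a \<tau> y = (\<Sum>j=1..m. a j * cis (2 * pi * \<tau> j * y)) / of_real \<bar>lam\<bar>"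

definition rho :: "real \<Rightarrow> nat \<Rightarrow> (nat \<Rightarrow> complex) \<Rightarrow> (nat \<Rightarrow> real) \<Rightarrow> real" where
  "rho lam m a \<tau> = - ln (exp_sum_mahler (\<tau> ` {1..m}) (mask lam m a \<tau>)) / ln \<bar>lam\<bar>"

end

theory Submission
  imports Defs
begin

text \<open>
  Write \<open>F\<close> for the Fourier transform of \<open>f\<close>. The refinement equation gives
  \<open>F y = A (y / lam) F (y / lam)\<close>, so that \<open>G L = (2 L)\<^sup>-\<^sup>1 \<integral>\<^bsub>-L\<^esub>\<^bsup>L\<^esup> ln \<bar>F\<bar>\<close> satisfies
  \<open>G (\<bar>lam\<bar> L) = G L + I L\<close>, where \<open>I L\<close> is the mean of \<open>ln \<bar>A\<bar>\<close> over \<open>[-L, L]\<close>. As \<open>I L\<close> tends to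
  \<open>ln M(A)\<close>, iteration yields \<open>G L \<sim> ln M(A) ln L / ln \<bar>lam\<bar>\<close>.

  For the convergence \<open>I L \<longrightarrow> ln M(A)\<close>, a continuous function of \<open>\<bar>A\<bar>\<^sup>2\<close> is uniformly approximated by
  polynomials in \<open>\<bar>A\<bar>\<^sup>2\<close>, which are trigonometric polynomials and have the right means because the
  frequencies \<open>r\<^sub>j\<close> are independent. The logarithm is truncated near the zeros of \<open>A\<close>; uniformly in
  the interval, the error is controlled by a bound \<open>\<bar>A y\<bar> \<ge> c \<Prod>\<^sub>i \<bar>y - z\<^sub>i\<bar>\<close> on intervals of a fixed length,
  which holds because at each point some derivative of \<open>A\<close> of bounded order is bounded away from 0.
\<close>

section \<open>Smooth functions\<close>

text \<open>Nothing is known beforehand about the zeros of F. Its continuity at 0, together with F 0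
  = 1, turns F y into the infinite product of the A (y / lam^k), k >= 1. This yields measurability,
  F nonzero almost everywhere, and integrability of ln |F|, near 0 at first and then by scaling on
  every bounded interval. Continuity at 0 comes from the order bound of the distribution, and the
  functional equation from cutoffs adapted to f; hence the work with smooth bump functions. In the
  mean of ln |A| the obstacle is that A need not be periodic, so no compactness is at hand on the
  line: all constants near the zeros must be independent of the position. A second obstacle is that
  P might a priori vanish on a set of positive measure of the torus; bounds uniform in L, passed to
  the limit, exclude this. The Mahler measure refers to an arbitrarily chosen P, and the limit is
  computed for exactly that choice.\<close>

lemma nderiv_0 [simp]: "nderiv 0 g = g"
  by (simp add: nderiv_def)

lemma nderiv_Suc: "nderiv (Suc n) g = (\<lambda>x. vector_derivative (nderiv n g) (at x))"
  by (simp add: nderiv_def)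

lemma nderiv_Suc': "nderiv (Suc n) g = nderiv n (nderiv 1 g)"
  by (simp add: nderiv_def funpow_Suc_right del: funpow.simps(2))

text \<open>Higher derivatives are iterates of a totalised operator; a whole chain of genuine
  derivatives identifies them.\<close>

lemma nderiv_family:
  assumes "h 0 = g" "\<And>n x. (h n has_vector_derivative h (Suc n) x) (at x)"
  shows "nderiv n g = h n"
proof (induction n)
  case (Suc n)
  then have "nderiv n g = h n" .
  then show ?case
    using vector_derivative_at[OF assms(2)] by (simp add: nderiv_Suc)
qed (simp add: assms)

lemma smooth_fun_family:
  assumes "h 0 = g" "\<And>n x. (h n has_vector_derivative h (Suc n) x) (at x)"
  shows "smooth_fun g"
  unfolding smooth_fun_def nderiv_family[OF assms]
  using differentiableI_vector[OF assms(2)] by blast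

lemma smooth_fun_has_nderiv:
  assumes "smooth_fun g"
  shows "(nderiv n g has_vector_derivative nderiv (Suc n) g x) (at x)"
  using assms by (auto simp: smooth_fun_def nderiv_Suc vector_derivative_works)

lemma smooth_fun_has_nderiv1:
  assumes "smooth_fun g"
  shows "(g has_vector_derivative nderiv 1 g x) (at x)"
  using smooth_fun_has_nderiv[OF assms, of 0] by simp

lemma smooth_fun_nderiv: "smooth_fun g \<Longrightarrow> smooth_fun (nderiv n g)"
  by (rule smooth_fun_family[where h = "\<lambda>k. nderiv (n + k) g"]) (auto intro: smooth_fun_has_nderiv)

lemma nderiv1_eqI:
  "(\<And>x. (g has_vector_derivative g' x) (at x)) \<Longrightarrow> nderiv 1 g = g'"
  using vector_derivative_at by (fastforce simp: nderiv_def)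

text \<open>Differentiating a product gives a sum of two products, so a class of products is stable
  under differentiation only after closing it under sums.\<close>

inductive_set sums_of :: "(real \<Rightarrow> complex) set \<Rightarrow> (real \<Rightarrow> complex) set" for X where
  base: "g \<in> X \<Longrightarrow> g \<in> sums_of X"
| add: "g \<in> sums_of X \<Longrightarrow> h \<in> sums_of X \<Longrightarrow> (\<lambda>x. g x + h x) \<in> sums_of X"

text \<open>Differentiation does not leave the sums of generators, so a choice \<open>D\<close> of
  derivatives can be iterated forever, and \<open>(D ^^ n) g\<close> is the chain that
  \<open>smooth_fun_family\<close> asks for.\<close>

lemma smooth_fun_coinduct:
  assumes "g \<in> sums_of X"
    and step: "\<And>g. g \<in> X \<Longrightarrow> \<exists>g'\<in>sums_of X. \<forall>x. (g has_vector_derivative g' x) (at x)"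
  shows "smooth_fun g"
proof -
  have "\<exists>g'\<in>sums_of X. \<forall>x. (g has_vector_derivative g' x) (at x)" if "g \<in> sums_of X" for g
    using that
  proof induction
    case (add g h)
    then obtain g' h' where "g' \<in> sums_of X" "h' \<in> sums_of X"
      "\<forall>x. (g has_vector_derivative g' x) (at x)" "\<forall>x. (h has_vector_derivative h' x) (at x)"
      by blast
    then show ?case
      by (intro bexI[where x="\<lambda>x. g' x + h' x"]) (auto intro: sums_of.add has_vector_derivative_add)
  qed (use step in blast)
  then obtain D where D: "\<And>g. g \<in> sums_of X \<Longrightarrow> D g \<in> sums_of X"
    "\<And>g x. g \<in> sums_of X \<Longrightarrow> (g has_vector_derivative D g x) (at x)"
    by metis
  have "(D ^^ n) g \<in> sums_of X" for n
    by (induction n) (auto simp: assms D)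
  then show ?thesis
    by (intro smooth_fun_family[where h = "\<lambda>n. (D ^^ n) g"]) (auto intro: D)
qed

lemma smooth_fun_add:
  assumes "smooth_fun f" "smooth_fun g"
  shows "smooth_fun (\<lambda>x. f x + g x)"
proof (rule smooth_fun_coinduct[where X = "Collect smooth_fun"])
  show "(\<lambda>x. f x + g x) \<in> sums_of (Collect smooth_fun)"
    using assms by (intro sums_of.intros) auto
  show "\<exists>g'\<in>sums_of (Collect smooth_fun). \<forall>x. (g has_vector_derivative g' x) (at x)"
    if "g \<in> Collect smooth_fun" for g
    using that smooth_fun_nderiv[of g 1] smooth_fun_has_nderiv1[of g]
    by (intro bexI[where x = "nderiv 1 g"] sums_of.base) (auto simp del: One_nat_def)
qed

lemma smooth_fun_mult:
  assumes "smooth_fun f" "smooth_fun g"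
  shows "smooth_fun (\<lambda>x. f x * g x)"
proof (rule smooth_fun_coinduct)
  let ?X = "{\<lambda>x. f x * g x | f g. smooth_fun f \<and> smooth_fun g}"
  show "(\<lambda>x. f x * g x) \<in> sums_of ?X"
    using assms by (intro sums_of.base) blast
  fix h assume "h \<in> ?X"
  then obtain f g where h: "h = (\<lambda>x. f x * g x)" and s: "smooth_fun f" "smooth_fun g"
    by blast
  have "(\<lambda>x. f x * nderiv 1 g x + nderiv 1 f x * g x) \<in> sums_of ?X"
    using s smooth_fun_nderiv by (intro sums_of.add sums_of.base) blast+
  then show "\<exists>g'\<in>sums_of ?X. \<forall>x. (h has_vector_derivative g' x) (at x)"
    unfolding h using s
    by (intro bexI allI) (auto intro!: has_vector_derivative_mult smooth_fun_has_nderiv1 simp del: One_nat_def)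
qed

lemma smooth_fun_const: "smooth_fun (\<lambda>x. c)"
  by (rule smooth_fun_family[where h = "\<lambda>n x. if n = 0 then c else 0"]) auto

lemma smooth_fun_diff:
  assumes "smooth_fun f" "smooth_fun g"
  shows "smooth_fun (\<lambda>x. f x - g x)"
  using smooth_fun_add[OF assms(1) smooth_fun_mult[OF smooth_fun_const[of "-1"] assms(2)]] by simp

lemma smooth_fun_affine:
  assumes "smooth_fun g"
  shows "smooth_fun (\<lambda>x. g (a * x + b))"
proof (rule smooth_fun_family[where h = "\<lambda>n x. of_real (a ^ n) * nderiv n g (a * x + b)"])
  fix n x
  have "((\<lambda>x. a * x + b) has_vector_derivative a) (at x)"
    by (auto intro!: derivative_eq_intros)
  then have "((nderiv n g \<circ> (\<lambda>x. a * x + b)) has_vector_derivative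
      a *\<^sub>R nderiv (Suc n) g (a * x + b)) (at x)"
    by (rule vector_diff_chain_at) (rule smooth_fun_has_nderiv[OF assms])
  from has_vector_derivative_mult_right[OF this, of "of_real (a ^ n)"]
  show "((\<lambda>x. of_real (a ^ n) * nderiv n g (a * x + b)) has_vector_derivative
      of_real (a ^ Suc n) * nderiv (Suc n) g (a * x + b)) (at x)"
    by (simp add: o_def scaleR_conv_of_real mult_ac)
qed auto

lemma smooth_fun_cis: "smooth_fun (\<lambda>x. cis (c * x))"
proof (rule smooth_fun_family[where h = "\<lambda>n x. (\<i> * of_real c) ^ n * exp (\<i> * of_real c * of_real x)"])
  fix n x
  have "((\<lambda>z. (\<i> * of_real c) ^ n * exp (\<i> * of_real c * z)) has_field_derivative
     (\<i> * of_real c) ^ Suc n * exp (\<i> * of_real c * of_real x)) (at (of_real x))"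
    by (auto intro!: derivative_eq_intros)
  from has_vector_derivative_real_field[OF this]
  show "((\<lambda>x. (\<i> * of_real c) ^ n * exp (\<i> * of_real c * of_real x)) has_vector_derivative
     (\<i> * of_real c) ^ Suc n * exp (\<i> * of_real c * of_real x)) (at x)" .
qed (auto simp: cis_conv_exp mult_ac)

text \<open>The products f g^(-n) with f smooth are closed under differentiation up to sums: the
  derivative is f' g^(-n) - n f g' g^(-n-1).\<close>

lemma smooth_fun_inverse:
  assumes "smooth_fun g" "\<And>x. g x \<noteq> 0"
  shows "smooth_fun (\<lambda>x. inverse (g x))"
proof (rule smooth_fun_coinduct)
  let ?X = "{\<lambda>x. f x * inverse (g x) ^ n | f n. smooth_fun f}"
  have "(\<lambda>x. inverse (g x)) \<in> ?X"
    using smooth_fun_const[of 1]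
    by (intro CollectI exI[where x = "\<lambda>x. 1"] exI[where x = 1]) auto
  then show "(\<lambda>x. inverse (g x)) \<in> sums_of ?X"
    by (rule sums_of.base)
  fix h assume "h \<in> ?X"
  then obtain f n where h: "h = (\<lambda>x. f x * inverse (g x) ^ n)" and s: "smooth_fun f"
    by blast
  have inv: "((\<lambda>x. inverse (g x)) has_vector_derivative - (nderiv 1 g x) * inverse (g x) ^ 2) (at x)" for x
    using field_vector_diff_chain_at[OF smooth_fun_has_nderiv1[OF assms(1)] DERIV_inverse[OF assms(2)], of x]
    by (simp add: o_def power2_eq_square)
  have pow: "((\<lambda>x. inverse (g x) ^ n) has_vector_derivative
     - (nderiv 1 g x) * inverse (g x) ^ 2 * (of_nat n * inverse (g x) ^ (n - 1))) (at x)" for x n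
  proof -
    have "((\<lambda>u. u ^ n) has_field_derivative of_nat n * u ^ (n - 1)) (at u)" for u :: complex
      by (auto intro!: derivative_eq_intros)
    from field_vector_diff_chain_at[OF inv this] show ?thesis by (simp add: o_def)
  qed
  have der: "(h has_vector_derivative
     (f x * (- (nderiv 1 g x) * inverse (g x) ^ 2 * (of_nat n * inverse (g x) ^ (n - 1))) +
      nderiv 1 f x * inverse (g x) ^ n)) (at x)" for x
    unfolding h by (intro has_vector_derivative_mult pow smooth_fun_has_nderiv1 s)
  have der': "(h has_vector_derivative
    ((of_nat n * - 1) * (f x * nderiv 1 g x) * inverse (g x) ^ (n + 1) + nderiv 1 f x * inverse (g x) ^ n)) (at x)" for x
  proof -
    have "f x * (- (nderiv 1 g x) * inverse (g x) ^ 2 * (of_nat n * inverse (g x) ^ (n - 1))) +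
        nderiv 1 f x * inverse (g x) ^ n =
      (of_nat n * - 1) * (f x * nderiv 1 g x) * inverse (g x) ^ (n + 1) + nderiv 1 f x * inverse (g x) ^ n"
      \<comment> \<open>For n = 0 the truncated exponent \<open>n - 1\<close> is harmless, since it
        comes with the factor \<open>of_nat n\<close>.\<close>
      by (cases n) (auto simp: algebra_simps power2_eq_square)
    then show ?thesis using der[of x] by (simp only:)
  qed
  have "smooth_fun (\<lambda>x. (of_nat n * - 1) * (f x * nderiv 1 g x))"
    by (intro smooth_fun_mult smooth_fun_const s smooth_fun_nderiv assms)
  then have "(\<lambda>x. (of_nat n * - 1) * (f x * nderiv 1 g x) * inverse (g x) ^ (n + 1)) \<in> ?X"
    by (intro CollectI exI[where x = "\<lambda>x. (of_nat n * - 1) * (f x * nderiv 1 g x)"] exI[where x = "n + 1"]) simp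
  moreover have "(\<lambda>x. nderiv 1 f x * inverse (g x) ^ n) \<in> ?X"
    using smooth_fun_nderiv[OF s, of 1] by (intro CollectI exI[where x = "nderiv 1 f"] exI[where x = n]) simp
  ultimately have "(\<lambda>x. (of_nat n * - 1) * (f x * nderiv 1 g x) * inverse (g x) ^ (n + 1) +
      nderiv 1 f x * inverse (g x) ^ n) \<in> sums_of ?X"
    by (intro sums_of.add sums_of.base)
  then show "\<exists>g'\<in>sums_of ?X. \<forall>x. (h has_vector_derivative g' x) (at x)"
    by (rule bexI[rotated]) (intro allI der')
qed

section \<open>Smooth cutoff functions\<close>

definition flat_exp :: "nat \<Rightarrow> real \<Rightarrow> real" where
  "flat_exp n x = (if x > 0 then (1 / x) ^ n * exp (- (1 / x)) else 0)"

lemma flat_exp_tendsto_0: "(flat_exp n \<longlongrightarrow> 0) (at 0)"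
proof -
  have "((\<lambda>u. u ^ n / exp u) \<longlongrightarrow> (0::real)) at_top"
    by (rule tendsto_power_div_exp_0)
  moreover have "filterlim (\<lambda>x::real. 1 / x) at_top (at_right 0)"
    using filterlim_inverse_at_top_right by (simp add: divide_inverse)
  ultimately have "((\<lambda>x. (1 / x) ^ n / exp (1 / x)) \<longlongrightarrow> (0::real)) (at_right 0)"
    by (rule filterlim_compose)
  then have "(flat_exp n \<longlongrightarrow> 0) (at_right 0)"
    by (rule Lim_transform_eventually)
      (auto simp: flat_exp_def eventually_at_filter exp_minus divide_inverse)
  moreover have "(flat_exp n \<longlongrightarrow> 0) (at_left 0)"
    by (rule Lim_transform_eventually[OF tendsto_const])
      (auto simp: flat_exp_def eventually_at_filter)
  ultimately show ?thesis
    by (simp add: filterlim_at_split)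
qed

text \<open>The powers of 1/x in \<open>flat_exp\<close> keep every derivative in the span of one
  family, all of whose members tend to 0 at 0.\<close>

lemma flat_exp_has_derivative:
  "(flat_exp n has_real_derivative flat_exp (n + 2) x - of_nat n * flat_exp (n + 1) x) (at x)"
proof -
  consider "x > 0" | "x < 0" | "x = 0" by linarith
  then show ?thesis
  proof cases
    case 1
    have "((\<lambda>x. (1 / x) ^ n * exp (- (1 / x))) has_real_derivative
       flat_exp (n + 2) x - of_nat n * flat_exp (n + 1) x) (at x)"
    proof -
      have "((\<lambda>u. u ^ n * exp (- u)) has_real_derivative
         (of_nat n * u ^ (n - 1) - u ^ n) * exp (- u)) (at u)" for u :: real
        by (auto intro!: derivative_eq_intros simp: algebra_simps)
      moreover have "((\<lambda>x. 1 / x) has_real_derivative - ((1 / x)\<^sup>2)) (at x)"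
        using 1 by (auto intro!: derivative_eq_intros simp: power2_eq_square)
      ultimately have "((\<lambda>x. (1 / x) ^ n * exp (- (1 / x))) has_real_derivative
         (of_nat n * (1 / x) ^ (n - 1) - (1 / x) ^ n) * exp (- (1 / x)) * - ((1 / x)\<^sup>2)) (at x)"
        by (rule DERIV_chain2)
      moreover have "(of_nat n * u ^ (n - 1) - u ^ n) * e * - (u\<^sup>2) = u ^ (n + 2) * e - of_nat n * (u ^ (n + 1) * e)"
        for u e :: real
        by (cases n) (auto simp: algebra_simps power2_eq_square)
      ultimately show ?thesis
        using 1 by (simp only: flat_exp_def if_True)
    qed
    then show ?thesis
      by (rule has_field_derivative_transform_within[where d = x]) (use 1 in \<open>auto simp: flat_exp_def dist_real_def\<close>)
  next
    case 2
    have "((\<lambda>x. 0) has_real_derivative flat_exp (n + 2) x - of_nat n * flat_exp (n + 1) x) (at x)"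
      using 2 by (simp add: flat_exp_def)
    then show ?thesis
      by (rule has_field_derivative_transform_within[where d = "-x"])
        (use 2 in \<open>auto simp: flat_exp_def dist_real_def\<close>)
  next
    case 3
    \<comment> \<open>The difference quotient at 0 is \<open>flat_exp (Suc n)\<close> itself, from
      either side.\<close>
    have "((\<lambda>y. (flat_exp n y - flat_exp n 0) / (y - 0)) \<longlongrightarrow> 0) (at 0)"
      by (rule Lim_transform_eventually[OF flat_exp_tendsto_0[of "Suc n"]])
        (auto simp: flat_exp_def eventually_at_filter)
    then show ?thesis
      using 3 by (simp add: has_field_derivative_iff flat_exp_def)
  qed
qed

lemma smooth_fun_flat_exp: "smooth_fun (\<lambda>x. of_real (flat_exp n x))"
proof (rule smooth_fun_coinduct)
  let ?X = "{\<lambda>x. of_real (c * flat_exp n x) :: complex | c n. True}"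
  have "(\<lambda>x. of_real (1 * flat_exp n x)) \<in> ?X" by blast
  then show "(\<lambda>x. of_real (flat_exp n x)) \<in> sums_of ?X"
    by (intro sums_of.base) simp
  fix h assume "h \<in> ?X"
  then obtain c n where h: "h = (\<lambda>x. of_real (c * flat_exp n x))" by blast
  let ?g = "\<lambda>x. of_real (c * flat_exp (n+2) x) + of_real ((- c * of_nat n) * flat_exp (n + 1) x) :: complex"
  have "((\<lambda>x. c * flat_exp n x) has_real_derivative (c * flat_exp (n+2) x + (- c * of_nat n) * flat_exp (n + 1) x)) (at x)" for x
    by (rule derivative_eq_intros flat_exp_has_derivative refl)+ (simp add: algebra_simps)
  then have "(h has_vector_derivative ?g x) (at x)" for x
    unfolding h of_real_add[symmetric]
    by (intro has_vector_derivative_of_real) (simp add: has_real_derivative_iff_has_vector_derivative)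
  moreover have "?g \<in> sums_of ?X"
    by (intro sums_of.add sums_of.base) blast+
  ultimately show "\<exists>g'\<in>sums_of ?X. \<forall>x. (h has_vector_derivative g' x) (at x)"
    by (intro bexI[where x = ?g]) auto
qed

text \<open>The quotient h(x) / (h(x) + h(1 - x)) with h = \<open>flat_exp 0\<close>: its
  denominator is positive because x or 1 - x is.\<close>

lemma smooth_step_exists:
  obtains s where "smooth_fun s" "\<And>x. x \<le> 0 \<Longrightarrow> s x = 0" "\<And>x. x \<ge> 1 \<Longrightarrow> s x = 1"
proof -
  let ?h = "\<lambda>x. of_real (flat_exp 0 x) :: complex"
  let ?r = "\<lambda>x. ?h ((- 1) * x + 1)"
  let ?s = "\<lambda>x. ?h x * inverse (?h x + ?r x)"
  have pos: "flat_exp 0 x + flat_exp 0 ((- 1) * x + 1) > 0" for x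
    by (auto simp: flat_exp_def add_pos_pos)
  have ne: "?h x + ?r x \<noteq> 0" for x
    unfolding of_real_add[symmetric] using pos[of x] by (metis of_real_eq_0_iff less_irrefl)
  show thesis
  proof
    show "smooth_fun ?s"
      by (intro smooth_fun_mult smooth_fun_inverse smooth_fun_add ne
          smooth_fun_affine[OF smooth_fun_flat_exp[of 0]] smooth_fun_flat_exp)
    show "?s x = 0" if "x \<le> 0" for x
      using that by (simp add: flat_exp_def)
    show "?s x = 1" if "x \<ge> 1" for x
      using that by (simp add: flat_exp_def)
  qed
qed

lemma smooth_bump_exists:
  assumes "r < R"
  obtains \<eta> where "smooth_fun \<eta>" "\<And>x. \<bar>x - c\<bar> \<le> r \<Longrightarrow> \<eta> x = 1" "\<And>x. \<bar>x - c\<bar> \<ge> R \<Longrightarrow> \<eta> x = 0"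
proof -
  obtain s where s: "smooth_fun s" "\<And>x. x \<le> 0 \<Longrightarrow> s x = 0" "\<And>x. x \<ge> 1 \<Longrightarrow> s x = 1"
    using smooth_step_exists by blast
  let ?d = "R - r"
  \<comment> \<open>A step from 0 to 1 across [c - R, c - r] times one from 1 to 0 across
    [c + r, c + R], in the shape that \<open>smooth_fun_affine\<close> matches.\<close>
  let ?e = "\<lambda>x. s (1 / ?d * x + (R - c) / ?d) * s (- 1 / ?d * x + (R + c) / ?d)"
  have e: "?e x = s ((x - c + R) / ?d) * s ((R - (x - c)) / ?d)" for x
    by (simp add: add_divide_distrib[symmetric] diff_divide_distrib[symmetric] algebra_simps)
  show thesis
  proof
    show "smooth_fun ?e"
      by (intro smooth_fun_mult smooth_fun_affine[OF s(1)])
    show "?e x = 1" if "\<bar>x - c\<bar> \<le> r" for x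
    proof -
      have "(x - c + R) / ?d \<ge> 1" "(R - (x - c)) / ?d \<ge> 1"
        using that assms by (auto simp: abs_le_iff le_divide_eq)
      then show ?thesis unfolding e using s(3) by simp
    qed
    show "?e x = 0" if "\<bar>x - c\<bar> \<ge> R" for x
    proof -
      have "(x - c + R) / ?d \<le> 0 \<or> (R - (x - c)) / ?d \<le> 0"
        using that assms by (auto simp: abs_if divide_le_0_iff split: if_splits)
      then show ?thesis unfolding e using s(2) by auto
    qed
  qed
qed

section \<open>Pairing with a distribution\<close>

lemma compact_fun_supp_iff: "compact (fun_supp \<phi>) \<longleftrightarrow> bounded {x. \<phi> x \<noteq> 0}"
  by (auto simp: fun_supp_def compact_eq_bounded_closed bounded_closure intro: bounded_subset[OF _ closure_subset])

lemma compact_fun_supp_subset: "compact K \<Longrightarrow> fun_supp \<phi> \<subseteq> K \<Longrightarrow> compact (fun_supp \<phi>)"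
  by (auto simp: compact_eq_bounded_closed fun_supp_def intro: bounded_subset)

lemma not_in_fun_supp: "x \<notin> fun_supp \<phi> \<Longrightarrow> \<phi> x = 0"
  using closure_subset[of "{x. \<phi> x \<noteq> 0}"] by (auto simp: fun_supp_def)

lemma fun_supp_mono: "(\<And>x. \<psi> x \<noteq> 0 \<Longrightarrow> \<phi> x \<noteq> 0) \<Longrightarrow> fun_supp \<psi> \<subseteq> fun_supp \<phi>"
  unfolding fun_supp_def by (intro closure_mono) auto

lemma fun_supp_subset_closed:
  "closed S \<Longrightarrow> (\<And>x. x \<notin> S \<Longrightarrow> \<phi> x = 0) \<Longrightarrow> fun_supp \<phi> \<subseteq> S"
  unfolding fun_supp_def by (intro closure_minimal) auto

lemma test_fun_mult_right:
  assumes "test_fun \<phi>" "smooth_fun \<psi>"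
  shows "test_fun (\<lambda>x. \<phi> x * \<psi> x)"
  using assms unfolding test_fun_def compact_fun_supp_iff
  by (auto intro: smooth_fun_mult bounded_subset)

lemma test_fun_smooth: "test_fun \<phi> \<Longrightarrow> smooth_fun \<phi>"
  by (simp add: test_fun_def)

lemma test_fun_add:
  assumes "test_fun \<phi>" "test_fun \<psi>"
  shows "test_fun (\<lambda>x. \<phi> x + \<psi> x)"
proof -
  have "bounded ({x. \<phi> x \<noteq> 0} \<union> {x. \<psi> x \<noteq> 0})"
    using assms unfolding test_fun_def compact_fun_supp_iff by simp
  then have "bounded {x. \<phi> x + \<psi> x \<noteq> 0}"
    by (rule bounded_subset) auto
  then show ?thesis
    using assms unfolding test_fun_def compact_fun_supp_iff by (auto intro: smooth_fun_add)
qed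

lemma test_fun_cmult:
  assumes "test_fun \<phi>"
  shows "test_fun (\<lambda>x. c * \<phi> x)"
  using test_fun_mult_right[OF assms smooth_fun_const[of c]] by (simp add: mult.commute)

lemma test_fun_diff: "test_fun \<phi> \<Longrightarrow> test_fun \<psi> \<Longrightarrow> test_fun (\<lambda>x. \<phi> x - \<psi> x)"
  using test_fun_add[OF _ test_fun_cmult[of \<psi> "-1"], of \<phi>] by simp

lemma test_bump_exists:
  assumes "0 < r" "r < R"
  obtains \<eta> where "test_fun \<eta>" "\<And>x. \<bar>x - c\<bar> \<le> r \<Longrightarrow> \<eta> x = 1" "fun_supp \<eta> \<subseteq> cball c R"
proof -
  obtain \<eta> where \<eta>: "smooth_fun \<eta>" "\<And>x. \<bar>x - c\<bar> \<le> r \<Longrightarrow> \<eta> x = 1" "\<And>x. \<bar>x - c\<bar> \<ge> R \<Longrightarrow> \<eta> x = 0"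
    using smooth_bump_exists[OF assms(2)] by blast
  have sub: "fun_supp \<eta> \<subseteq> cball c R"
    by (rule fun_supp_subset_closed) (auto simp: dist_real_def abs_minus_commute intro!: \<eta>(3))
  moreover from this have "compact (fun_supp \<eta>)"
    by (rule compact_fun_supp_subset[rotated]) simp
  ultimately show thesis
    using that \<eta> by (auto simp: test_fun_def)
qed

locale distrib =
  fixes u
  assumes distribution: "distribution u"
begin

lemma add: "test_fun \<phi> \<Longrightarrow> test_fun \<psi> \<Longrightarrow> u (\<lambda>x. \<phi> x + \<psi> x) = u \<phi> + u \<psi>"
  using distribution unfolding distribution_def by blast

lemma cmult: "test_fun \<phi> \<Longrightarrow> u (\<lambda>x. c * \<phi> x) = c * u \<phi>"
  using distribution unfolding distribution_def by blast

lemma bound: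
  assumes "compact K"
  obtains C N where "\<And>\<phi>. test_fun \<phi> \<Longrightarrow> fun_supp \<phi> \<subseteq> K \<Longrightarrow>
           cmod (u \<phi>) \<le> C * (\<Sum>k\<le>N. SUP x. cmod (nderiv k \<phi> x))"
  using distribution assms unfolding distribution_def by blast

lemma zero: "u (\<lambda>x. 0) = 0"
proof -
  have "test_fun (\<lambda>x. 0)"
    by (auto simp: test_fun_def fun_supp_def smooth_fun_const)
  from cmult[OF this, of 0] show ?thesis by simp
qed

lemma diff: "test_fun \<phi> \<Longrightarrow> test_fun \<psi> \<Longrightarrow> u (\<lambda>x. \<phi> x - \<psi> x) = u \<phi> - u \<psi>"
  using add[of \<phi> "\<lambda>x. -1 * \<psi> x"] cmult[of \<psi> "-1"] test_fun_cmult[of \<psi> "-1"] by simp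

text \<open>
  Cover \<open>fun_supp \<phi>\<close> by finitely many intervals on which bumps \<open>b\<^sub>i\<close> supported in open sets
  annihilated by \<open>u\<close> equal 1: then \<open>\<phi> \<Prod>\<^sub>i (1 - b\<^sub>i) = 0\<close>, while each factor \<open>1 - b\<^sub>i\<close> leaves the
  value of \<open>u\<close> unchanged.
\<close>

lemma vanishes_off_support:
  assumes \<phi>: "test_fun \<phi>" and disj: "fun_supp \<phi> \<inter> dist_supp u = {}"
  shows "u \<phi> = 0"
proof -
  define K where "K = fun_supp \<phi>"
  have "compact K" using \<phi> by (simp add: test_fun_def K_def)
  have "\<exists>e. e > 0 \<and> (\<forall>\<psi>. test_fun \<psi> \<longrightarrow> fun_supp \<psi> \<subseteq> cball x (2 * e) \<longrightarrow> u \<psi> = 0)" if "x \<in> K" for x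
  proof -
    have "x \<notin> dist_supp u" using disj that K_def by auto
    then obtain U where U: "open U" "x \<in> U" "\<And>\<psi>. test_fun \<psi> \<Longrightarrow> fun_supp \<psi> \<subseteq> U \<Longrightarrow> u \<psi> = 0"
      by (auto simp: dist_supp_def)
    then obtain d where "d > 0" "cball x d \<subseteq> U"
      by (meson open_contains_cball)
    then show ?thesis
      using U(3) by (intro exI[where x = "d/2"]) auto
  qed
  then obtain e where e: "\<And>x. x \<in> K \<Longrightarrow> e x > 0"
    "\<And>x \<psi>. x \<in> K \<Longrightarrow> test_fun \<psi> \<Longrightarrow> fun_supp \<psi> \<subseteq> cball x (2 * e x) \<Longrightarrow> u \<psi> = 0"
    by metis
  have "\<exists>T\<subseteq>K. finite T \<and> K \<subseteq> (\<Union>x\<in>T. ball x (e x))"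
    by (rule compactE_image[OF \<open>compact K\<close>, of K "\<lambda>x. ball x (e x)"]) (use e(1) in auto)
  then obtain T where T: "T \<subseteq> K" "finite T" "K \<subseteq> (\<Union>x\<in>T. ball x (e x))"
    by blast
  have "\<exists>b. test_fun b \<and> (\<forall>y. \<bar>y - x\<bar> \<le> e x \<longrightarrow> b y = 1) \<and> fun_supp b \<subseteq> cball x (2 * e x)" if "x \<in> K" for x
    using test_bump_exists[of "e x" "2 * e x" x] e(1)[OF that] by (metis mult_2 less_add_same_cancel1)
  then obtain b where b: "\<And>x. x \<in> K \<Longrightarrow> test_fun (b x)"
    "\<And>x y. x \<in> K \<Longrightarrow> \<bar>y - x\<bar> \<le> e x \<Longrightarrow> b x y = 1" "\<And>x. x \<in> K \<Longrightarrow> fun_supp (b x) \<subseteq> cball x (2 * e x)"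
    by metis
  have "test_fun (\<lambda>y. \<phi> y * (\<Prod>x\<in>S. 1 - b x y)) \<and> u (\<lambda>y. \<phi> y * (\<Prod>x\<in>S. 1 - b x y)) = u \<phi>"
    if "finite S" "S \<subseteq> K" for S
    using that
  proof induction
    case (insert x S)
    let ?p = "\<lambda>y. \<phi> y * (\<Prod>x\<in>S. 1 - b x y)"
    have p: "test_fun ?p" "u ?p = u \<phi>" using insert by auto
    have x: "x \<in> K" using insert by auto
    have pb: "test_fun (\<lambda>y. ?p y * b x y)"
      by (rule test_fun_mult_right[OF p(1) test_fun_smooth[OF b(1)[OF x]]])
    have "fun_supp (\<lambda>y. ?p y * b x y) \<subseteq> cball x (2 * e x)"
      by (rule order.trans[OF fun_supp_mono[where \<phi> = "b x"] b(3)[OF x]]) auto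
    then have "u (\<lambda>y. ?p y * b x y) = 0"
      using e(2)[OF x pb] by blast
    then have "u (\<lambda>y. ?p y - ?p y * b x y) = u \<phi>"
      using diff[OF p(1) pb] p(2) by (simp only: diff_zero)
    moreover have "test_fun (\<lambda>y. ?p y - ?p y * b x y)"
      by (rule test_fun_diff[OF p(1) pb])
    moreover have "\<phi> y * (\<Prod>x\<in>insert x S. 1 - b x y) = ?p y - ?p y * b x y" for y
      unfolding prod.insert[OF insert.hyps] by (simp add: algebra_simps)
    ultimately show ?case by presburger
  qed (use \<phi> in auto)
  from this[OF T(2,1)] have "u (\<lambda>y. \<phi> y * (\<Prod>x\<in>T. 1 - b x y)) = u \<phi>" by blast
  moreover have "\<phi> y * (\<Prod>x\<in>T. 1 - b x y) = 0" for y
  proof (cases "y \<in> K")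
    case True
    then obtain x where "x \<in> T" "y \<in> ball x (e x)" using T by blast
    then have "x \<in> T" "1 - b x y = 0"
      using b(2)[of x y] T by (auto simp: dist_real_def abs_minus_commute)
    then show ?thesis using T(2) by (auto intro!: prod_zero)
  next
    case False
    then show ?thesis by (simp add: K_def not_in_fun_supp)
  qed
  ultimately show ?thesis using zero by simp
qed

text \<open>Two cutoffs agree on a whole neighbourhood of the support, so even the closed support of
  their difference avoids \<open>dist_supp u\<close>.\<close>

lemma cutoff_independent:
  assumes "cutoff u \<eta>" "cutoff u \<eta>'" "smooth_fun \<psi>"
  shows "u (\<lambda>x. \<eta> x * \<psi> x) = u (\<lambda>x. \<eta>' x * \<psi> x)"
proof -
  obtain U where U: "open U" "dist_supp u \<subseteq> U" "\<And>x. x \<in> U \<Longrightarrow> \<eta> x = 1"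
    using assms by (auto simp: cutoff_def)
  obtain V where V: "open V" "dist_supp u \<subseteq> V" "\<And>x. x \<in> V \<Longrightarrow> \<eta>' x = 1"
    using assms by (auto simp: cutoff_def)
  have t: "test_fun (\<lambda>x. \<eta> x * \<psi> x)" "test_fun (\<lambda>x. \<eta>' x * \<psi> x)"
    using assms by (auto simp: cutoff_def intro: test_fun_mult_right)
  have "fun_supp (\<lambda>x. \<eta> x * \<psi> x - \<eta>' x * \<psi> x) \<subseteq> - (U \<inter> V)"
    using U V by (intro fun_supp_subset_closed) auto
  moreover have "test_fun (\<lambda>x. \<eta> x * \<psi> x - \<eta>' x * \<psi> x)"
    by (rule test_fun_diff[OF t])
  ultimately have "u (\<lambda>x. \<eta> x * \<psi> x - \<eta>' x * \<psi> x) = 0"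
    using U V by (intro vanishes_off_support) auto
  then show ?thesis using diff[OF t] by simp
qed

text \<open>The pairing uses a cutoff picked by \<open>SOME\<close>; from here on any convenient
  cutoff may replace it.\<close>

lemma dist_fourier_cutoff:
  assumes "cutoff u \<eta>"
  shows "dist_fourier u y = u (\<lambda>x. \<eta> x * cis (2 * pi * y * x))"
proof -
  have "cutoff u (SOME \<eta>. cutoff u \<eta>)"
    by (rule someI[of "cutoff u", OF assms])
  from cutoff_independent[OF this assms smooth_fun_cis[of "2 * pi * y"]] show ?thesis
    by (simp add: dist_fourier_def dist_pairing_def mult_ac)
qed

end

section \<open>Continuity of the Fourier transform at the origin\<close>

lemma nderiv_add:
  assumes "smooth_fun f" "smooth_fun g"
  shows "nderiv n (\<lambda>x. f x + g x) = (\<lambda>x. nderiv n f x + nderiv n g x)"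
  by (rule nderiv_family[where h = "\<lambda>n x. nderiv n f x + nderiv n g x"])
    (auto intro!: has_vector_derivative_add smooth_fun_has_nderiv assms)

lemma nderiv_cmult:
  assumes "smooth_fun f"
  shows "nderiv n (\<lambda>x. c * f x) = (\<lambda>x. c * nderiv n f x)"
  by (rule nderiv_family[where h = "\<lambda>n x. c * nderiv n f x"])
    (auto intro!: has_vector_derivative_mult_right smooth_fun_has_nderiv assms)

lemma continuous_on_nderiv: "smooth_fun f \<Longrightarrow> continuous_on S (nderiv n f)"
  by (meson continuous_at_imp_continuous_on has_vector_derivative_continuous smooth_fun_has_nderiv)

lemma fun_supp_nderiv: "fun_supp (nderiv n f) \<subseteq> fun_supp f"
proof (induction n)
  case (Suc n)
  have "nderiv (Suc n) f x = 0" if "x \<notin> fun_supp (nderiv n f)" for x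
  proof -
    have "open (- fun_supp (nderiv n f))" by (simp add: fun_supp_def open_Compl)
    moreover have "nderiv n f y = 0" if "y \<in> - fun_supp (nderiv n f)" for y
      using that by (simp add: not_in_fun_supp)
    ultimately have "(nderiv n f has_vector_derivative 0) (at x)"
      using that by (intro has_vector_derivative_transform_within_open[OF has_vector_derivative_const[of 0], of "- fun_supp (nderiv n f)"]) auto
    then show ?thesis by (simp add: nderiv_Suc vector_derivative_at)
  qed
  then have "fun_supp (nderiv (Suc n) f) \<subseteq> fun_supp (nderiv n f)"
    by (intro fun_supp_subset_closed) (auto simp: fun_supp_def)
  then show ?case using Suc by blast
qed simp

lemma test_fun_nderiv_bounded:
  assumes "test_fun f"
  obtains B where "B > 0" "\<And>x. cmod (nderiv n f x) \<le> B"
proof -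
  have "compact (nderiv n f ` fun_supp f)"
    using assms by (intro compact_continuous_image continuous_on_nderiv) (auto simp: test_fun_def)
  then have "bounded (nderiv n f ` fun_supp f)" by (rule compact_imp_bounded)
  then obtain B where B: "B > 0" "\<And>x. x \<in> fun_supp f \<Longrightarrow> cmod (nderiv n f x) \<le> B"
    by (auto simp: bounded_pos)
  have "cmod (nderiv n f x) \<le> B" for x
  proof (cases "x \<in> fun_supp f")
    case False
    then have "nderiv n f x = 0"
      using fun_supp_nderiv[of n f] by (blast intro: not_in_fun_supp)
    then show ?thesis using B by simp
  qed (use B in auto)
  then show thesis using that B by blast
qed

lemma test_fun_nderiv:
  assumes "test_fun f" shows "test_fun (nderiv n f)"
  using assms compact_fun_supp_subset[OF _ fun_supp_nderiv]
  by (auto simp: test_fun_def smooth_fun_nderiv)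

text \<open>
  The derivative of \<open>f (e\<^sub>y - 1)\<close>, with \<open>e\<^sub>y x = e\<^bsup>iyx\<^esup>\<close>, is \<open>f' (e\<^sub>y - 1) + iy f (e\<^sub>y - 1) + iy f\<close>,
  so that induction on the order applies.
\<close>

lemma nderiv_mult_cis_small:
  assumes "test_fun f" "e > 0"
  shows "\<exists>d>0. \<forall>y x. \<bar>y\<bar> < d \<longrightarrow> cmod (nderiv n (\<lambda>x. f x * (cis (y * x) - 1)) x) \<le> e"
  using assms
proof (induction n arbitrary: f e)
  case 0
  obtain R where R: "R > 0" "\<And>x. f x \<noteq> 0 \<Longrightarrow> \<bar>x\<bar> \<le> R"
    using 0 by (auto simp: test_fun_def compact_fun_supp_iff bounded_pos)
  obtain B where B: "B > 0" "\<And>x. cmod (f x) \<le> B"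
    using test_fun_nderiv_bounded[OF 0(1), of 0] by auto
  have lip: "cmod (cis t - 1) \<le> \<bar>t\<bar>" for t
  proof -
    have "cmod (exp (\<i> * of_real t) - 1) = 2 * \<bar>sin (t / 2)\<bar>"
      using dist_exp_i_1[of t] by simp
    then show ?thesis using abs_sin_x_le_abs_x[of "t / 2"] by (simp add: cis_conv_exp)
  qed
  have "cmod (f x * (cis (y * x) - 1)) \<le> e" if "\<bar>y\<bar> < e / (B * R)" for x y
  proof (cases "f x = 0")
    case False
    have "cmod (cis (y * x) - 1) \<le> \<bar>y\<bar> * R"
      using lip[of "y * x"] mult_left_mono[OF R(2)[OF False], of "\<bar>y\<bar>"] by (simp add: abs_mult)
    then have "cmod (f x * (cis (y * x) - 1)) \<le> B * (\<bar>y\<bar> * R)"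
      unfolding norm_mult using B by (intro mult_mono) auto
    also have "\<dots> \<le> e" using that B R by (simp add: field_simps)
    finally show ?thesis .
  qed (use 0 in auto)
  then show ?case using B R 0 by (intro exI[where x = "e / (B * R)"]) auto
next
  case (Suc n)
  obtain B where B: "B > 0" "\<And>x. cmod (nderiv n f x) \<le> B"
    using test_fun_nderiv_bounded[OF Suc.prems(1), of n] by auto
  obtain d1 where d1: "d1 > 0" "\<And>y x. \<bar>y\<bar> < d1 \<Longrightarrow> cmod (nderiv n (\<lambda>x. nderiv 1 f x * (cis (y * x) - 1)) x) \<le> e / 2"
    using Suc.IH[OF test_fun_nderiv[OF Suc.prems(1), of 1], of "e / 2"] Suc.prems by auto
  obtain d2 where d2: "d2 > 0" "\<And>y x. \<bar>y\<bar> < d2 \<Longrightarrow> cmod (nderiv n (\<lambda>x. f x * (cis (y * x) - 1)) x) \<le> 1"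
    using Suc.IH[OF Suc.prems(1), of 1] by auto
  have f: "smooth_fun f" using Suc.prems by (simp add: test_fun_def)
  \<comment> \<open>The last entry makes |y| (1 + B) at most e / 2; the 1 is the crude bound that
    \<open>d2\<close> gives for the undifferentiated factor.\<close>
  define d where "d = Min {d1, d2, e / (2 * (B + 1))}"
  have "cmod (nderiv (Suc n) (\<lambda>x. f x * (cis (y * x) - 1)) x) \<le> e" if "\<bar>y\<bar> < d" for x y
  proof -
    let ?g = "\<lambda>x. f x * (cis (y * x) - 1)" and ?h = "\<lambda>x. nderiv 1 f x * (cis (y * x) - 1)"
    have y: "\<bar>y\<bar> < d1" "\<bar>y\<bar> < d2" "\<bar>y\<bar> < e / (2 * (B + 1))"
      using that by (auto simp: d_def)
    have g: "smooth_fun ?g" and h: "smooth_fun ?h"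
      by (intro smooth_fun_mult smooth_fun_diff smooth_fun_const smooth_fun_cis f smooth_fun_nderiv)+
    have cis: "((\<lambda>x. cis (y * x) - 1) has_vector_derivative (\<i> * of_real y * cis (y * x))) (at x)" for x
    proof -
      have "((\<lambda>z. exp (\<i> * of_real y * z) - 1) has_field_derivative
         (\<i> * of_real y) * exp (\<i> * of_real y * of_real x)) (at (of_real x))"
        by (auto intro!: derivative_eq_intros)
      from has_vector_derivative_real_field[OF this] show ?thesis
        by (simp add: cis_conv_exp mult_ac)
    qed
    have "nderiv 1 ?g = (\<lambda>x. f x * (\<i> * of_real y * cis (y * x)) + nderiv 1 f x * (cis (y * x) - 1))"
      by (intro nderiv1_eqI has_vector_derivative_mult cis smooth_fun_has_nderiv1 f)
    also have "\<dots> = (\<lambda>x. ?h x + \<i> * of_real y * (?g x + f x))"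
      by (auto simp: fun_eq_iff algebra_simps)
    finally have "nderiv (Suc n) ?g = nderiv n (\<lambda>x. ?h x + \<i> * of_real y * (?g x + f x))"
      by (simp only: nderiv_Suc')
    also have "\<dots> = (\<lambda>x. nderiv n ?h x + \<i> * of_real y * (nderiv n ?g x + nderiv n f x))"
      using f g h by (simp add: nderiv_add nderiv_cmult smooth_fun_mult smooth_fun_const smooth_fun_add del: One_nat_def)
    finally have "cmod (nderiv (Suc n) ?g x) \<le> cmod (nderiv n ?h x) + \<bar>y\<bar> * (cmod (nderiv n ?g x) + cmod (nderiv n f x))"
      by (auto simp: norm_mult intro!: norm_triangle_le add_mono mult_left_mono norm_triangle_ineq)
    also have "\<dots> \<le> e / 2 + \<bar>y\<bar> * (1 + B)"
      using d1(2)[OF y(1)] d2(2)[OF y(2)] B(2) by (intro add_mono mult_left_mono) auto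
    also have "\<dots> \<le> e"
      using y(3) B(1) by (simp add: field_simps)
    finally show ?thesis .
  qed
  moreover have "d > 0" using d1 d2 B Suc.prems by (auto simp: d_def)
  ultimately show ?case by blast
qed

lemma (in distrib) tendsto_cis_0:
  assumes \<eta>: "test_fun \<eta>"
  shows "((\<lambda>y. u (\<lambda>x. \<eta> x * cis (y * x))) \<longlongrightarrow> u \<eta>) (at 0)"
proof (rule tendstoI)
  fix e :: real assume e: "e > 0"
  obtain C N where CN: "\<And>\<phi>. test_fun \<phi> \<Longrightarrow> fun_supp \<phi> \<subseteq> fun_supp \<eta> \<Longrightarrow>
           cmod (u \<phi>) \<le> C * (\<Sum>k\<le>N. SUP x. cmod (nderiv k \<phi> x))"
    using bound[of "fun_supp \<eta>"] \<eta> by (auto simp: test_fun_def)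
  \<comment> \<open>The order bound has N + 1 summands. \<open>C\<close> carries no sign, hence |C|;
    the + 1 beside it avoids division by 0, and the 2 leaves room for strictness.\<close>
  define e' where "e' = e / (2 * (\<bar>C\<bar> + 1) * (real N + 1))"
  have e': "e' > 0" using e by (auto simp: e'_def intro!: divide_pos_pos mult_pos_pos)
  have "\<exists>d>0. \<forall>y x. \<bar>y\<bar> < d \<longrightarrow> cmod (nderiv n (\<lambda>x. \<eta> x * (cis (y * x) - 1)) x) \<le> e'" for n
    by (rule nderiv_mult_cis_small[OF \<eta> e'])
  then obtain d where d: "\<And>n. d n > 0"
    "\<And>n x y. \<bar>y\<bar> < d n \<Longrightarrow> cmod (nderiv n (\<lambda>x. \<eta> x * (cis (y * x) - 1)) x) \<le> e'"
    by metis
  define D where "D = Min (d ` {..N})"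
  have "dist (u (\<lambda>x. \<eta> x * cis (y * x))) (u \<eta>) < e" if "\<bar>y\<bar> < D" for y
  proof -
    let ?g = "\<lambda>x. \<eta> x * (cis (y * x) - 1)"
    have t: "test_fun (\<lambda>x. \<eta> x * cis (y * x))" "test_fun ?g"
      by (intro test_fun_mult_right \<eta> smooth_fun_cis smooth_fun_diff smooth_fun_const)+
    have eq: "u (\<lambda>x. \<eta> x * cis (y * x)) - u \<eta> = u ?g"
      using diff[OF t(1) \<eta>] by (simp add: algebra_simps)
    have le: "cmod (u ?g) \<le> C * (\<Sum>k\<le>N. SUP x. cmod (nderiv k ?g x))"
      by (intro CN t fun_supp_mono) auto
    have "(SUP x. cmod (nderiv k ?g x)) \<le> e'" "0 \<le> (SUP x. cmod (nderiv k ?g x))" if "k \<le> N" for k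
    proof -
      have "\<bar>y\<bar> < d k" using that \<open>\<bar>y\<bar> < D\<close> by (auto simp: D_def)
      then have b: "cmod (nderiv k ?g x) \<le> e'" for x by (rule d(2))
      then show "(SUP x. cmod (nderiv k ?g x)) \<le> e'" by (intro cSUP_least) auto
      \<comment> \<open>A real supremum dominates its family only if that is bounded above, which
        \<open>b\<close> provides. Nonnegativity is what allows \<open>C\<close> to be replaced by
        |C|.\<close>
      have "cmod (nderiv k ?g 0) \<le> (SUP x. cmod (nderiv k ?g x))"
        by (rule cSUP_upper) (auto intro!: bdd_aboveI2[where M = e'] b)
      then show "0 \<le> (SUP x. cmod (nderiv k ?g x))" using norm_ge_zero order.trans by blast
    qed
    then have "0 \<le> (\<Sum>k\<le>N. SUP x. cmod (nderiv k ?g x))" "(\<Sum>k\<le>N. SUP x. cmod (nderiv k ?g x)) \<le> (real N + 1) * e'"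
      using sum_bounded_above[of "{..N}" "\<lambda>k. SUP x. cmod (nderiv k ?g x)" e'] by (auto intro!: sum_nonneg simp: add.commute)
    note le
    also have "C * (\<Sum>k\<le>N. SUP x. cmod (nderiv k ?g x)) \<le> \<bar>C\<bar> * ((real N + 1) * e')"
      using \<open>0 \<le> (\<Sum>k\<le>N. SUP x. cmod (nderiv k ?g x))\<close> \<open>(\<Sum>k\<le>N. SUP x. cmod (nderiv k ?g x)) \<le> (real N + 1) * e'\<close>
      by (intro mult_mono) auto
    also have "\<dots> \<le> (\<bar>C\<bar> + 1) * ((real N + 1) * e')"
      using e' by (intro mult_right_mono) auto
    also have "\<dots> = e / 2"
    proof -
      have "\<bar>C\<bar> + 1 \<noteq> 0" "real N + 1 \<noteq> 0" by linarith+
      then show ?thesis by (simp add: e'_def divide_simps)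
    qed
    also have "\<dots> < e" using e by simp
    finally show ?thesis using eq by (simp add: dist_norm)
  qed
  moreover have "D > 0" using d by (auto simp: D_def)
  ultimately show "\<forall>\<^sub>F y in at 0. dist (u (\<lambda>x. \<eta> x * cis (y * x))) (u \<eta>) < e"
    by (auto simp: eventually_at intro!: exI[where x = D])
qed

text \<open>This continuity is what lets the iterated functional equation converge to an infinite
  product.\<close>

lemma (in distrib) dist_fourier_tendsto:
  assumes "compact (dist_supp u)"
  shows "(dist_fourier u \<longlongrightarrow> dist_fourier u 0) (at 0)"
proof -
  obtain R where R: "R > 0" "\<And>x. x \<in> dist_supp u \<Longrightarrow> \<bar>x\<bar> \<le> R"
    using compact_imp_bounded[OF assms] by (auto simp: bounded_pos)
  obtain \<eta> where \<eta>: "test_fun \<eta>" "\<And>x. \<bar>x - 0\<bar> \<le> R + 1 \<Longrightarrow> \<eta> x = 1"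
    using R(1) by (rule_tac test_bump_exists[of "R + 1" "R + 2" 0]) auto
  have c: "cutoff u \<eta>"
    unfolding cutoff_def
    using \<eta> R(2) by (auto intro!: exI[where x = "ball 0 (R + 1)"]) fastforce
  have "filterlim (\<lambda>y. 2 * pi * y) (at 0) (at 0)"
    by (auto simp: filterlim_at eventually_at_filter intro!: tendsto_eq_intros)
  from filterlim_compose[OF tendsto_cis_0[OF \<eta>(1)] this] show ?thesis
    unfolding dist_fourier_cutoff[OF c, abs_def] by simp
qed

text \<open>
  The cutoff must be 1 near the support of \<open>u\<close> and near its preimages under all the maps
  \<open>x \<mapsto> (x + \<tau> j) / lam\<close>.
\<close>

lemma (in distrib) dist_fourier_refinable:
  assumes "compact (dist_supp u)" "refinable lam m a \<tau> u" "\<bar>lam\<bar> > 1"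
  shows "dist_fourier u y = mask lam m a \<tau> (y / lam) * dist_fourier u (y / lam)"
proof -
  obtain R where R: "R > 0" "\<And>x. x \<in> dist_supp u \<Longrightarrow> \<bar>x\<bar> \<le> R"
    using compact_imp_bounded[OF assms(1)] by (auto simp: bounded_pos)
  \<comment> \<open>For |x| < R + 1 this gives |x + \<tau> j| <= S, and division by lam, with |lam|
    > 1, stays within [-S, S].\<close>
  define S where "S = R + 1 + (\<Sum>j=1..m. \<bar>\<tau> j\<bar>)"
  have S: "S \<ge> R + 1" by (auto simp: S_def sum_nonneg)
  have S\<tau>: "R + 1 + \<bar>\<tau> j\<bar> \<le> S" if "j \<in> {1..m}" for j
    using member_le_sum[of j "{1..m}" "\<lambda>j. \<bar>\<tau> j\<bar>"] that by (auto simp: S_def)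
  obtain \<eta> where \<eta>: "test_fun \<eta>" "\<And>x. \<bar>x - 0\<bar> \<le> S \<Longrightarrow> \<eta> x = 1"
    using R(1) S by (rule_tac test_bump_exists[of S "S + 1" 0]) auto
  have cutoffI: "cutoff u \<zeta>" if "test_fun \<zeta>" "\<And>x. \<bar>x\<bar> < R + 1 \<Longrightarrow> \<zeta> x = 1" for \<zeta>
    unfolding cutoff_def
    using that R(2) by (auto intro!: exI[where x = "ball 0 (R + 1)"]) fastforce
  have c: "cutoff u \<eta>"
    using \<eta> S by (intro cutoffI) auto
  have lam: "lam \<noteq> 0" using assms by auto
  let ?e = "\<lambda>y x. cis (2 * pi * y * x)"
  have *: "dist_affine lam (\<tau> j) u (\<lambda>x. \<eta> x * ?e y x) =
      cis (2 * pi * \<tau> j * (y / lam)) * dist_fourier u (y / lam) / of_real \<bar>lam\<bar>" if j: "j \<in> {1..m}" for j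
  proof -
    \<comment> \<open>The change of variables turns the cutoff into \<open>?z\<close>, again a
      cutoff for \<open>u\<close>, and the exponential into a constant phase times the one of
      frequency y / lam.\<close>
    let ?z = "\<lambda>x. \<eta> (1 / lam * x + \<tau> j / lam)"
    have "test_fun ?z"
    proof -
      obtain B where B: "\<And>x. \<eta> x \<noteq> 0 \<Longrightarrow> \<bar>x\<bar> \<le> B"
        using \<eta>(1) by (auto simp: test_fun_def compact_fun_supp_iff bounded_pos)
      have "\<bar>x\<bar> \<le> \<bar>lam\<bar> * B + \<bar>\<tau> j\<bar>" if "?z x \<noteq> 0" for x
      proof -
        have "\<bar>(x + \<tau> j) / lam\<bar> \<le> B" using B[OF that] by (simp add: add_divide_distrib)
        then have "\<bar>x + \<tau> j\<bar> \<le> \<bar>lam\<bar> * B" using lam by (simp add: abs_divide pos_divide_le_eq mult.commute)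
        then show ?thesis by linarith
      qed
      then have "bounded {x. ?z x \<noteq> 0}"
        by (auto simp: bounded_real)
      then show ?thesis
        unfolding test_fun_def compact_fun_supp_iff
        using smooth_fun_affine[OF test_fun_smooth[OF \<eta>(1)]] by blast
    qed
    moreover have "?z x = 1" if "\<bar>x\<bar> < R + 1" for x
    proof -
      have "\<bar>x + \<tau> j\<bar> \<le> S" using S\<tau>[OF j] that by linarith
      also have "\<dots> \<le> S * \<bar>lam\<bar>" using assms(3) S R by (simp add: mult_le_cancel_left1)
      finally have "\<bar>(x + \<tau> j) / lam\<bar> \<le> S" using lam by (simp add: abs_divide pos_divide_le_eq)
      then show ?thesis using \<eta>(2)[of "(x + \<tau> j) / lam"] by (simp add: add_divide_distrib)
    qed
    ultimately have cz: "cutoff u ?z" by (rule cutoffI)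
    have "(\<lambda>x. \<eta> ((x + \<tau> j) / lam) * ?e y ((x + \<tau> j) / lam)) =
       (\<lambda>x. cis (2 * pi * \<tau> j * (y / lam)) * (?z x * ?e (y / lam) x))"
      by (auto simp: fun_eq_iff cis_mult add_divide_distrib algebra_simps)
    then have "u (\<lambda>x. \<eta> ((x + \<tau> j) / lam) * ?e y ((x + \<tau> j) / lam)) =
       cis (2 * pi * \<tau> j * (y / lam)) * dist_fourier u (y / lam)"
      using cmult[OF test_fun_mult_right[OF \<open>test_fun ?z\<close> smooth_fun_cis[of "2 * pi * (y / lam)"]]]
        dist_fourier_cutoff[OF cz, of "y / lam"]
      by (simp only:)
    then show ?thesis by (simp add: dist_affine_def)
  qed
  have "dist_fourier u y = u (\<lambda>x. \<eta> x * ?e y x)"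
    by (rule dist_fourier_cutoff[OF c])
  also have "\<dots> = (\<Sum>j=1..m. a j * dist_affine lam (\<tau> j) u (\<lambda>x. \<eta> x * ?e y x))"
    by (rule assms(2)[unfolded refinable_def, rule_format, OF test_fun_mult_right[OF \<eta>(1) smooth_fun_cis]])
  also have "\<dots> = (\<Sum>j=1..m. a j * (cis (2 * pi * \<tau> j * (y / lam)) * dist_fourier u (y / lam) / of_real \<bar>lam\<bar>))"
    by (intro sum.cong) (simp_all add: *)
  also have "\<dots> = mask lam m a \<tau> (y / lam) * dist_fourier u (y / lam)"
    by (simp add: mask_def sum_distrib_left sum_distrib_right sum_divide_distrib mult_ac)
  finally show ?thesis .
qed

section \<open>Exponential sums near their zeros\<close>

text \<open>Differentiation under the integral sign. It provides the divided function with its own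
  chain of derivatives, so that zeros can be split off one after another.\<close>

lemma integral_scaled_has_derivative:
  fixes h h' :: "real \<Rightarrow> real"
  assumes h: "\<And>y. (h has_real_derivative h' y) (at y)" and h': "continuous_on UNIV h'"
  shows "((\<lambda>y. integral {0..1} (\<lambda>t. t ^ i * h (w + t * (y - w)))) has_real_derivative
      integral {0..1} (\<lambda>t. t ^ Suc i * h' (w + t * (y - w)))) (at y)"
proof -
  have hc: "continuous_on UNIV h"
    using h by (meson DERIV_continuous_on has_field_derivative_at_within)
  have "((\<lambda>y. integral (cbox 0 1) (\<lambda>t. t ^ i * h (w + t * (y - w)))) has_real_derivative
      integral (cbox 0 1) (\<lambda>t. t ^ Suc i * h' (w + t * (y - w)))) (at y within UNIV)"
  proof (rule leibniz_rule_field_derivative)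
    fix x t :: real
    have "((\<lambda>x. w + t * (x - w)) has_real_derivative t) (at x)"
      by (auto intro!: derivative_eq_intros)
    from DERIV_cmult[OF DERIV_chain2[OF h this], of "t ^ i"]
    show "((\<lambda>x. t ^ i * h (w + t * (x - w))) has_real_derivative t ^ Suc i * h' (w + t * (x - w)))
        (at x within UNIV)"
      by (simp add: mult_ac)
  next
    show "(\<lambda>t. t ^ i * h (w + t * (x - w))) integrable_on cbox 0 1" for x
      by (intro integrable_continuous continuous_intros continuous_on_compose2[OF hc]) auto
    show "continuous_on (UNIV \<times> cbox 0 1) (\<lambda>(x, t). t ^ Suc i * h' (w + t * (x - w)))"
      unfolding split_beta
      by (intro continuous_intros continuous_on_compose2[OF h']) auto
  qed auto
  then show ?thesis by simp
qed

text \<open>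
  Subtracting from \<open>h\<close> its value at the point of \<open>{a..b}\<close> where \<open>\<bar>h\<bar>\<close> is minimal does not increase
  \<open>\<bar>h\<bar>\<close> there and creates a zero \<open>w\<close>; the quotient by \<open>y - w\<close> is \<open>\<integral>\<^sub>0\<^sup>1 h'(w + t(y - w)) dt\<close>, whose
  derivative of order \<open>k - 1\<close> is at least \<open>\<delta>/k\<close>.
\<close>

lemma abs_ge_prod_of_deriv_ge:
  fixes h :: "nat \<Rightarrow> real \<Rightarrow> real"
  assumes "\<And>i y. (h i has_real_derivative h (Suc i) y) (at y)"
    and "\<And>y. y \<in> {a..b} \<Longrightarrow> h k y \<ge> \<delta>" "\<delta> \<ge> 0" "a \<le> b"
  shows "\<exists>z. \<forall>y\<in>{a..b}. \<delta> / fact k * (\<Prod>i<k. \<bar>y - z i\<bar>) \<le> \<bar>h 0 y\<bar>"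
  using assms(1-3)
proof (induction k arbitrary: h \<delta>)
  case 0
  then show ?case by (auto intro: order.trans[OF _ abs_ge_self])
next
  case (Suc k)
  have cont: "continuous_on S (h i)" for S i
    using Suc.prems(1) by (meson DERIV_continuous_on has_field_derivative_at_within)
  obtain w where w: "w \<in> {a..b}" "\<And>y. y \<in> {a..b} \<Longrightarrow> \<bar>h 0 w\<bar> \<le> \<bar>h 0 y\<bar>"
    using continuous_attains_inf[of "{a..b}" "\<lambda>y. \<bar>h 0 y\<bar>"] assms(4)
      continuous_on_rabs[OF cont[of "{a..b}" 0]]
    by auto
  define q where "q = (\<lambda>i y. integral {0..1} (\<lambda>t. t ^ i * h (Suc i) (w + t * (y - w))))"
  have q': "(q i has_real_derivative q (Suc i) y) (at y)" for i y
    unfolding q_def by (rule integral_scaled_has_derivative) (auto intro: Suc.prems cont)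
  \<comment> \<open>The integral of t^k over [0, 1] is 1 / (k + 1); these factors accumulate to the
    factorial.\<close>
  have qk: "q k y \<ge> \<delta> / real (Suc k)" if y: "y \<in> {a..b}" for y
  proof -
    have "((\<lambda>t. t ^ k * \<delta>) has_integral \<delta> / real (Suc k)) {0..1}"
    proof -
      have "((\<lambda>t. t ^ k * \<delta>) has_integral (1 ^ Suc k / real (Suc k) * \<delta> - 0 ^ Suc k / real (Suc k) * \<delta>)) {0..1}"
        by (rule fundamental_theorem_of_calculus)
          (auto intro!: derivative_eq_intros simp: has_real_derivative_iff_has_vector_derivative[symmetric] simp del: power_Suc)
      then show ?thesis by simp
    qed
    moreover have "(\<lambda>t. t ^ k * h (Suc k) (w + t * (y - w))) integrable_on {0..1}"
      by (intro integrable_continuous_interval continuous_intros continuous_on_compose2[OF cont[of UNIV]]) auto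
    moreover have "t ^ k * \<delta> \<le> t ^ k * h (Suc k) (w + t * (y - w))" if "t \<in> {0..1}" for t
    proof -
      have "w + t * (y - w) \<in> {a..b}"
        using convexD_alt[of "{a..b}" w y t] w y that by (simp add: algebra_simps)
      then show ?thesis using Suc.prems(2) that by (intro mult_left_mono) auto
    qed
    ultimately show ?thesis
      unfolding q_def by (intro has_integral_le[OF _ integrable_integral]) auto
  qed
  obtain z where z: "\<And>y. y \<in> {a..b} \<Longrightarrow> \<delta> / real (Suc k) / fact k * (\<Prod>i<k. \<bar>y - z i\<bar>) \<le> \<bar>q 0 y\<bar>"
    using Suc.IH[OF q' qk] divide_nonneg_pos[OF Suc.prems(3), of "real (Suc k)"] by (metis of_nat_0_less_iff zero_less_Suc)
  have fac: "h 0 y - h 0 w = (y - w) * q 0 y" for y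
  proof -
    have "((\<lambda>t. (y - w) * h 1 (w + t * (y - w))) has_integral h 0 (w + 1 * (y - w)) - h 0 (w + 0 * (y - w))) {0..1}"
    proof (rule fundamental_theorem_of_calculus)
      fix t :: real
      have "((\<lambda>t. w + t * (y - w)) has_real_derivative (y - w)) (at t)"
        by (auto intro!: derivative_eq_intros)
      from DERIV_chain2[OF Suc.prems(1)[of 0] this]
      show "((\<lambda>t. h 0 (w + t * (y - w))) has_vector_derivative (y - w) * h 1 (w + t * (y - w))) (at t within {0..1})"
        by (simp add: has_real_derivative_iff_has_vector_derivative mult.commute has_vector_derivative_at_within)
    qed simp
    from integral_unique[OF this] show ?thesis by (simp add: q_def)
  qed
  have min: "\<bar>h 0 y - h 0 w\<bar> \<le> \<bar>h 0 y\<bar>" if y: "y \<in> {a..b}" for y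
  proof (cases "h 0 w = 0")
    case False
    \<comment> \<open>Otherwise the intermediate value theorem would give a zero in the interval,
      and the minimum of |h 0| would be 0.\<close>
    have sgn: "h 0 w > 0 \<longleftrightarrow> h 0 y > 0"
    proof (rule ccontr)
      assume neg: "(h 0 w > 0) \<noteq> (h 0 y > 0)"
      have "\<exists>x\<in>{a..b}. h 0 x = 0"
      proof -
        have "connected (h 0 ` {a..b})"
          by (intro connected_continuous_image cont) simp
        moreover have "h 0 w \<in> h 0 ` {a..b}" "h 0 y \<in> h 0 ` {a..b}" using w y by auto
        ultimately have "0 \<in> h 0 ` {a..b}"
          using neg by (meson connectedD_interval not_less less_imp_le)
        then show ?thesis by auto
      qed
      then show False using w(2) False by fastforce
    qed
    then show ?thesis using w(2)[OF y] False by (cases "h 0 w > 0") auto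
  qed simp
  show ?case
  proof (intro exI ballI)
    fix y assume y: "y \<in> {a..b}"
    have "\<delta> / fact (Suc k) * (\<Prod>i<Suc k. \<bar>y - (z(k := w)) i\<bar>) =
        \<bar>y - w\<bar> * (\<delta> / real (Suc k) / fact k * (\<Prod>i<k. \<bar>y - z i\<bar>))"
      by simp
    also have "\<dots> \<le> \<bar>y - w\<bar> * \<bar>q 0 y\<bar>" by (intro mult_left_mono z y) auto
    also have "\<dots> = \<bar>h 0 y - h 0 w\<bar>" by (simp add: fac abs_mult)
    also have "\<dots> \<le> \<bar>h 0 y\<bar>" by (rule min[OF y])
    finally show "\<delta> / fact (Suc k) * (\<Prod>i<Suc k. \<bar>y - (z(k := w)) i\<bar>) \<le> \<bar>h 0 y\<bar>" .
  qed
qed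

text \<open>The frequencies absorb the factor 2 pi. Distinct frequencies and nonzero coefficients
  prevent the terms from cancelling.\<close>

locale exp_sum =
  fixes I :: "'i set" and b :: "'i \<Rightarrow> complex" and \<omega> :: "'i \<Rightarrow> real"
  assumes fin: "finite I" and ne: "I \<noteq> {}" and inj: "inj_on \<omega> I"
    and b: "\<And>j. j \<in> I \<Longrightarrow> b j \<noteq> 0"
begin

definition D :: "nat \<Rightarrow> real \<Rightarrow> complex" where
  "D k y = (\<Sum>j\<in>I. b j * (\<i> * of_real (\<omega> j)) ^ k * cis (\<omega> j * y))"

abbreviation A :: "real \<Rightarrow> complex" where "A \<equiv> D 0"

lemma D_deriv: "(D k has_vector_derivative D (Suc k) y) (at y)"
proof -
  have "((\<lambda>z. \<Sum>j\<in>I. b j * (\<i> * of_real (\<omega> j)) ^ k * exp (\<i> * of_real (\<omega> j) * z)) has_field_derivative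
     (\<Sum>j\<in>I. b j * (\<i> * of_real (\<omega> j)) ^ Suc k * exp (\<i> * of_real (\<omega> j) * of_real y))) (at (of_real y))"
    by (intro DERIV_sum) (auto intro!: derivative_eq_intros)
  from has_vector_derivative_real_field[OF this]
  show ?thesis by (simp add: D_def[abs_def] cis_conv_exp mult_ac)
qed

lemma D_bound: "cmod (D k y) \<le> (\<Sum>j\<in>I. cmod (b j) * \<bar>\<omega> j\<bar> ^ k)"
  unfolding D_def by (rule sum_norm_le) (simp add: norm_mult norm_power)

text \<open>
  Applying the differential operator \<open>\<Prod>\<^sub>j (d/dy - i\<omega>\<^sub>j)\<close>, with one index \<open>j\<^sub>0\<close> left out, annihilates every
  term except that of \<open>j\<^sub>0\<close>, which has constant modulus.
\<close>

lemma some_derivative_large: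
  obtains \<delta> N where "\<delta> > 0" "\<And>y. \<exists>k\<le>N. cmod (D k y) \<ge> \<delta>"
proof -
  obtain j0 where j0: "j0 \<in> I" using ne by auto
  define p where "p = (\<Prod>j\<in>I - {j0}. [:- (\<i> * of_real (\<omega> j)), 1:])"
  have p: "poly p z = (\<Prod>j\<in>I - {j0}. z - \<i> * of_real (\<omega> j))" for z
    by (simp add: p_def poly_prod)
  have p0: "poly p (\<i> * of_real (\<omega> j)) = 0" if "j \<in> I" "j \<noteq> j0" for j
    unfolding p using that fin by (intro prod_zero) auto
  have p1: "poly p (\<i> * of_real (\<omega> j0)) \<noteq> 0"
    unfolding p using fin j0 inj by (auto simp: inj_on_def)
  \<comment> \<open>If all derivatives were below v / S, with v the modulus of the surviving term,
    then v <= (S - 1) v / S < v; the + 1 gives this strictness.\<close>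
  define S where "S = (\<Sum>k\<le>degree p. cmod (coeff p k)) + 1"
  have S: "S > 0" by (auto simp: S_def intro!: add_nonneg_pos sum_nonneg)
  define v where "v = cmod (b j0 * poly p (\<i> * of_real (\<omega> j0)))"
  have v: "v > 0" using b[OF j0] p1 by (simp add: v_def)
  have "\<exists>k\<le>degree p. cmod (D k y) \<ge> v / S" for y
  proof (rule ccontr)
    assume "\<not> ?thesis"
    then have small: "cmod (D k y) \<le> v / S" if "k \<le> degree p" for k using that by force
    have "(\<Sum>k\<le>degree p. coeff p k * D k y) =
        (\<Sum>j\<in>I. b j * cis (\<omega> j * y) * (\<Sum>k\<le>degree p. coeff p k * (\<i> * of_real (\<omega> j)) ^ k))"
      unfolding D_def sum_distrib_left by (subst sum.swap) (simp add: mult_ac)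
    also have "\<dots> = (\<Sum>j\<in>I. b j * cis (\<omega> j * y) * poly p (\<i> * of_real (\<omega> j)))"
      by (simp add: poly_altdef)
    also have "\<dots> = b j0 * cis (\<omega> j0 * y) * poly p (\<i> * of_real (\<omega> j0))"
      using fin j0 p0 by (subst sum.remove[of _ j0]) (auto intro!: sum.neutral)
    finally have "v = cmod (\<Sum>k\<le>degree p. coeff p k * D k y)"
      by (simp add: v_def norm_mult)
    also have "\<dots> \<le> (\<Sum>k\<le>degree p. cmod (coeff p k) * (v / S))"
      by (rule sum_norm_le) (use small in \<open>auto simp: norm_mult simp del: times_divide_eq_right intro!: mult_left_mono\<close>)
    also have "\<dots> = (S - 1) * (v / S)"
      by (simp add: S_def sum_distrib_right sum_divide_distrib)
    also have "\<dots> < v" using v S by (simp add: field_simps)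
    finally show False by simp
  qed
  then show thesis using that v S by (metis divide_pos_pos)
qed

text \<open>At x some derivative of order at most N has modulus at least \<delta>. A rotation makes
  its real part at least \<delta> / 2, and the global bound M on the next derivative keeps this
  above \<delta> / 4 at distance l. None of the constants depends on x.\<close>

lemma lower_bound_local:
  obtains c l :: real and N :: nat where "c > 0" "l > 0" "l \<le> 1 / 2" "N > 0"
    "\<And>x. \<exists>z. \<forall>y\<in>{x - l..x + l}. c * (\<Prod>i<N. \<bar>y - z i\<bar>) \<le> cmod (A y)"
proof -
  obtain \<delta> N where \<delta>: "\<delta> > 0" and large: "\<And>y. \<exists>k\<le>N. cmod (D k y) \<ge> \<delta>"
    using some_derivative_large by blast
  define M where "M = (\<Sum>k\<le>Suc N. \<Sum>j\<in>I. cmod (b j) * \<bar>\<omega> j\<bar> ^ k) + 1"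
  have M: "M > 0" by (auto simp: M_def intro!: add_nonneg_pos sum_nonneg simp del: sum.atMost_Suc)
  have DM: "cmod (D k y) \<le> M" if "k \<le> Suc N" for k y
  proof -
    have "(\<Sum>j\<in>I. cmod (b j) * \<bar>\<omega> j\<bar> ^ k) \<le> (\<Sum>k\<le>Suc N. \<Sum>j\<in>I. cmod (b j) * \<bar>\<omega> j\<bar> ^ k)"
      by (rule member_le_sum) (use that in \<open>auto intro!: sum_nonneg\<close>)
    then show ?thesis using D_bound[of k y] unfolding M_def by linarith
  qed
  \<comment> \<open>With \<delta> / (4 M) the chosen derivative changes by at most \<delta> / 4. The
    bound 1 / 2 keeps |y - x| below 1 and the length of the interval at most 1.\<close>
  define l where "l = min (1 / 2) (\<delta> / (4 * M))"
  have l: "l > 0" "l \<le> 1 / 2" "M * l \<le> \<delta> / 4"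
    using \<delta> M by (auto simp: l_def min_def field_simps)
  define c where "c = \<delta> / 4 / fact (Suc N)"
  have "\<exists>z. \<forall>y\<in>{x - l..x + l}. c * (\<Prod>i<Suc N. \<bar>y - z i\<bar>) \<le> cmod (A y)" for x
  proof -
    obtain k where k: "k \<le> N" "cmod (D k x) \<ge> \<delta>" using large by blast
    \<comment> \<open>As |w| <= |Re w| + |Im w|, one of the numbers Re w, -Re w, Im w, -Im w is at
      least half the modulus; \<sigma> is the matching fourth root of unity.\<close>
    have "\<exists>\<sigma>. cmod \<sigma> = 1 \<and> Re (\<sigma> * D k x) \<ge> \<delta> / 2"
    proof -
      have "\<bar>Re (D k x)\<bar> \<ge> \<delta> / 2 \<or> \<bar>Im (D k x)\<bar> \<ge> \<delta> / 2"
        using cmod_le[of "D k x"] k(2) by linarith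
      then consider "Re (D k x) \<ge> \<delta> / 2" | "- Re (D k x) \<ge> \<delta> / 2" | "Im (D k x) \<ge> \<delta> / 2" | "- Im (D k x) \<ge> \<delta> / 2"
        by linarith
      then show ?thesis
      proof cases
        case 1 then show ?thesis by (intro exI[of _ 1]) auto
      next
        case 2 then show ?thesis by (intro exI[of _ "-1"]) auto
      next
        case 3 then show ?thesis by (intro exI[of _ "-\<i>"]) auto
      next
        case 4 then show ?thesis by (intro exI[of _ "\<i>"]) auto
      qed
    qed
    then obtain \<sigma> where \<sigma>: "cmod \<sigma> = 1" "Re (\<sigma> * D k x) \<ge> \<delta> / 2" by blast
    define h where "h = (\<lambda>i y. Re (\<sigma> * D i y))"
    have h': "(h i has_real_derivative h (Suc i) y) (at y)" for i y
    proof -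
      have "((\<lambda>y. \<sigma> * D i y) has_vector_derivative \<sigma> * D (Suc i) y) (at y)"
        by (intro has_vector_derivative_mult_right D_deriv)
      from has_field_derivative_Re[OF this] show ?thesis by (simp add: h_def)
    qed
    have habs: "\<bar>h i y\<bar> \<le> cmod (D i y)" for i y
      using abs_Re_le_cmod[of "\<sigma> * D i y"] \<sigma>(1) by (simp add: h_def norm_mult)
    have hk: "h k y \<ge> \<delta> / 4" if y: "y \<in> {x - l..x + l}" for y
    proof -
      have "norm (h k y - h k x) \<le> M * norm (y - x)"
      proof (rule field_differentiable_bound[of UNIV "h k" "h (Suc k)"])
        show "norm (h (Suc k) z) \<le> M" for z
          using habs[of "Suc k" z] DM[of "Suc k" z] k by auto
      qed (auto intro: h')
      also have "\<dots> \<le> M * l" using y M by (intro mult_left_mono) auto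
      finally have "\<bar>h k y - h k x\<bar> \<le> \<delta> / 4" using l(3) by simp
      moreover have "h k x \<ge> \<delta> / 2" using \<sigma>(2) by (simp add: h_def)
      ultimately show ?thesis by linarith
    qed
    have "\<exists>z. \<forall>y\<in>{x - l..x + l}. \<delta> / 4 / fact k * (\<Prod>i<k. \<bar>y - z i\<bar>) \<le> \<bar>h 0 y\<bar>"
      by (rule abs_ge_prod_of_deriv_ge[OF h' hk]) (use \<delta> l in auto)
    then obtain z where z: "\<And>y. y \<in> {x - l..x + l} \<Longrightarrow> \<delta> / 4 / fact k * (\<Prod>i<k. \<bar>y - z i\<bar>) \<le> \<bar>h 0 y\<bar>"
      by blast
    show ?thesis
    proof (intro exI ballI)
      fix y assume y: "y \<in> {x - l..x + l}"
      \<comment> \<open>Padding with the centre x gives the same number of factors everywhere; each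
        extra factor is at most 1, so the product only decreases. \<open>Suc N\<close> factors make
        their number positive.\<close>
      let ?z = "\<lambda>i. if i < k then z i else x"
      have "(\<Prod>i<Suc N. \<bar>y - ?z i\<bar>) = (\<Prod>i<k. \<bar>y - ?z i\<bar>) * (\<Prod>i=k..<Suc N. \<bar>y - ?z i\<bar>)"
        using k prod.atLeastLessThan_concat[of 0 k "Suc N" "\<lambda>i. \<bar>y - ?z i\<bar>"] by (simp add: lessThan_atLeast0)
      also have "(\<Prod>i=k..<Suc N. \<bar>y - ?z i\<bar>) \<le> 1"
        using y l by (intro prod_le_1) (auto simp: abs_le_iff)
      then have "(\<Prod>i<k. \<bar>y - ?z i\<bar>) * (\<Prod>i=k..<Suc N. \<bar>y - ?z i\<bar>) \<le> (\<Prod>i<k. \<bar>y - ?z i\<bar>) * 1"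
        by (rule mult_left_mono) (auto intro!: prod_nonneg)
      finally have "(\<Prod>i<Suc N. \<bar>y - ?z i\<bar>) \<le> (\<Prod>i<k. \<bar>y - z i\<bar>)" by simp
      moreover have "c \<le> \<delta> / 4 / fact k"
        unfolding c_def using \<delta> k by (intro divide_left_mono fact_mono) auto
      ultimately have "c * (\<Prod>i<Suc N. \<bar>y - ?z i\<bar>) \<le> \<delta> / 4 / fact k * (\<Prod>i<k. \<bar>y - z i\<bar>)"
        using \<delta> by (intro mult_mono prod_nonneg) auto
      also have "\<dots> \<le> cmod (A y)" using z[OF y] habs[of 0 y] by linarith
      finally show "c * (\<Prod>i<Suc N. \<bar>y - ?z i\<bar>) \<le> cmod (A y)" .
    qed
  qed
  moreover have "c > 0" using \<delta> by (simp add: c_def)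
  ultimately show thesis using that[of c l "Suc N"] l by blast
qed

end

text \<open>The 5 is 2 + 2 + 1: the integral of u^(-1/2) over [0, 1] for each side of z, and at most
  1 from points farther than 1 from z. It depends neither on z nor on x.\<close>

lemma nn_integral_abs_powr_neg_half:
  fixes z :: real
  assumes "l \<le> 1 / 2"
  shows "(\<integral>\<^sup>+y. ennreal (\<bar>y - z\<bar> powr (-1/2)) * indicator {x - l..x + l} y \<partial>lborel) \<le> 5"
proof -
  let ?g = "\<lambda>y::real. ennreal (y powr (-1/2)) * indicator {0..1} y"
  have g: "(\<integral>\<^sup>+y. ?g y \<partial>lborel) = 2"
  proof -
    have "((\<lambda>y::real. y powr (-1/2)) has_integral 2) {0..1}"
      using has_integral_powr_from_0[of "-1/2" 1] by simp
    from nn_integral_has_integral_lebesgue'[OF _ this] show ?thesis by simp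
  qed
  have [measurable]: "?g \<in> borel_measurable borel" by simp
  have shift: "(\<integral>\<^sup>+y. ?g (c * (y - z)) \<partial>lborel) = 2" if "\<bar>c\<bar> = 1" for c
  proof -
    have "(\<integral>\<^sup>+y. ?g y \<partial>lborel) = \<bar>c\<bar> * (\<integral>\<^sup>+y. ?g (- c * z + c * y) \<partial>lborel)"
      by (rule nn_integral_real_affine) (use that in auto)
    then show ?thesis using that g by (simp add: algebra_simps)
  qed
  have "(\<integral>\<^sup>+y. ennreal (\<bar>y - z\<bar> powr (-1/2)) * indicator {x - l..x + l} y \<partial>lborel)
     \<le> (\<integral>\<^sup>+y. ?g (1 * (y - z)) + ?g (-1 * (y - z)) + indicator {x - l..x + l} y \<partial>lborel)"
  proof (rule nn_integral_mono)
    fix y :: real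
    consider "0 \<le> y - z" "y - z \<le> 1" | "-1 \<le> y - z" "y - z \<le> 0" | "\<bar>y - z\<bar> > 1" by linarith
    then show "ennreal (\<bar>y - z\<bar> powr (-1/2)) * indicator {x - l..x + l} y
        \<le> ?g (1 * (y - z)) + ?g (-1 * (y - z)) + indicator {x - l..x + l} y"
    proof cases
      case 1
      then have "ennreal (\<bar>y - z\<bar> powr (-1/2)) = ?g (1 * (y - z))" by simp
      then show ?thesis by (auto simp: indicator_def split: if_splits intro: add_increasing2 add_increasing)
    next
      case 2
      then have "ennreal (\<bar>y - z\<bar> powr (-1/2)) = ?g (-1 * (y - z))" by simp
      then show ?thesis by (auto simp: indicator_def split: if_splits intro: add_increasing2 add_increasing)
    next
      case 3
      then have "\<bar>y - z\<bar> powr (-1/2) \<le> \<bar>y - z\<bar> powr 0" by (intro powr_mono) auto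
      then have "\<bar>y - z\<bar> powr (-1/2) \<le> 1" using 3 by (auto split: if_splits)
      then have "ennreal (\<bar>y - z\<bar> powr (-1/2)) \<le> 1" by (simp only: ennreal_le_1)
      then show ?thesis by (auto simp: indicator_def split: if_splits intro: add_increasing2 add_increasing)
    qed
  qed
  also have "\<dots> = 2 + 2 + emeasure lborel {x - l..x + l}"
    by (subst nn_integral_add nn_integral_indicator; (measurable; fail)?)+ (simp only: shift[of 1] shift[of "-1"] abs_one abs_minus)
  also have "\<dots> \<le> 2 + 2 + 1"
    using assms by (intro add_left_mono) (auto simp: emeasure_lborel_Icc_eq ennreal_le_1)
  finally show ?thesis by simp
qed

context exp_sum
begin

lemma A_continuous: "continuous_on S A"
  using D_deriv by (meson continuous_at_imp_continuous_on has_vector_derivative_continuous)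

lemma A_measurable [measurable]: "A \<in> borel_measurable borel"
  by (rule borel_measurable_continuous_onI[OF A_continuous])

text \<open>On each of countably many intervals covering the line, the local lower bound confines
  the zeros to N points.\<close>

lemma countable_zeros: "countable {y. A y = 0}"
proof -
  obtain c l :: real and N :: nat where c: "c > 0" "l > 0" "l \<le> 1 / 2" "N > 0" and
    z: "\<And>x. \<exists>z. \<forall>y\<in>{x - l..x + l}. c * (\<Prod>i<N. \<bar>y - z i\<bar>) \<le> cmod (A y)"
    using lower_bound_local by blast
  obtain Z where Z: "\<And>x y. y \<in> {x - l..x + l} \<Longrightarrow> c * (\<Prod>i<N. \<bar>y - Z x i\<bar>) \<le> cmod (A y)"
    using z by metis
  have "{y. A y = 0} \<subseteq> (\<Union>n::int. Z (of_int n * l) ` {..<N})"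
  proof
    fix y assume "y \<in> {y. A y = 0}"
    define n where "n = \<lfloor>y / l\<rfloor>"
    have "of_int n \<le> y / l" "y / l < of_int n + 1" by (auto simp: n_def)
    then have "y \<in> {of_int n * l - l..of_int n * l + l}"
      using c by (auto simp: field_simps)
    from Z[OF this] have "c * (\<Prod>i<N. \<bar>y - Z (of_int n * l) i\<bar>) \<le> 0"
      using \<open>y \<in> {y. A y = 0}\<close> by simp
    then have "(\<Prod>i<N. \<bar>y - Z (of_int n * l) i\<bar>) = 0"
      using c by (simp add: mult_le_0_iff prod_nonneg antisym)
    then show "y \<in> (\<Union>n::int. Z (of_int n * l) ` {..<N})" by auto
  qed
  then show ?thesis by (rule countable_subset) auto
qed

lemma AE_nonzero: "AE y in lborel. A y \<noteq> 0"
  using countable_imp_null_set_lborel[OF countable_zeros] by (intro AE_I'[where N = "{y. A y = 0}"]) auto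

lemma AE_nonzero_scaled:
  assumes "c \<noteq> 0" shows "AE y in lborel. A (c * y) \<noteq> 0"
proof -
  have "{y. A (c * y) = 0} \<subseteq> (\<lambda>y. y / c) ` {y. A y = 0}"
  proof
    fix y assume "y \<in> {y. A (c * y) = 0}"
    then show "y \<in> (\<lambda>y. y / c) ` {y. A y = 0}"
      using assms by (intro image_eqI[where x = "c * y"]) auto
  qed
  then have "countable {y. A (c * y) = 0}"
    using countable_zeros by (meson countable_image countable_subset)
  then show ?thesis
    using countable_imp_null_set_lborel by (intro AE_I'[where N = "{y. A (c * y) = 0}"]) auto
qed

text \<open>The lower bound splits the excess of ln e over ln |A| into one term for each z i, and ln
  u <= u bounds each term by an integrable inverse square root. The result is a positive power of e,
  hence small with e.\<close>

lemma local_tail: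
  assumes c: "c > 0" and l: "l \<le> 1 / 2" and N: "N > 0" and e: "e > 0"
    and z: "\<And>y. y \<in> {x - l..x + l} \<Longrightarrow> c * (\<Prod>i<N. \<bar>y - z i\<bar>) \<le> cmod (A y)"
  shows "(\<integral>\<^sup>+y. ennreal (max 0 (ln e - ln (cmod (A y)))) * indicator {x - l..x + l} y \<partial>lborel)
    \<le> ennreal (10 * real N * (e / c) powr (1 / (2 * real N)))"
proof -
  \<comment> \<open>Chosen so that s^(2 N) = e / c: each of the N factors receives the share 2 ln s
    of ln (e / c).\<close>
  define s where "s = (e / c) powr (1 / (2 * real N))"
  have s: "s > 0" using c e by (simp add: s_def)
  have ln_s: "2 * real N * ln s = ln e - ln c"
    using c e N by (simp add: s_def ln_powr ln_div)
  \<comment> \<open>At the points z i the default values of \<open>ln\<close> and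
    \<open>powr\<close> at 0 could spoil the pointwise estimate.\<close>
  have "AE y in lborel. y \<notin> z ` {..<N}"
    by (intro AE_I'[where N = "z ` {..<N}"] countable_imp_null_set_lborel) auto
  then have "AE y in lborel. ennreal (max 0 (ln e - ln (cmod (A y)))) * indicator {x - l..x + l} y
     \<le> (\<Sum>i<N. ennreal (2 * s) * (ennreal (\<bar>y - z i\<bar> powr (-1/2)) * indicator {x - l..x + l} y))"
  proof eventually_elim
    case (elim y)
    show ?case
    proof (cases "y \<in> {x - l..x + l}")
      case True
      have u: "\<bar>y - z i\<bar> > 0" if "i < N" for i using elim that by auto
      then have pr: "(\<Prod>i<N. \<bar>y - z i\<bar>) > 0" by (intro prod_pos) auto
      have "ln c + (\<Sum>i<N. ln \<bar>y - z i\<bar>) = ln (c * (\<Prod>i<N. \<bar>y - z i\<bar>))"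
        using c pr u by (subst ln_mult, simp, simp, subst ln_prod) fastforce+
      also have "\<dots> \<le> ln (cmod (A y))"
        using z[OF True] mult_pos_pos[OF c pr] by (intro ln_mono) auto
      finally have "ln e - ln (cmod (A y)) \<le> 2 * real N * ln s - (\<Sum>i<N. ln \<bar>y - z i\<bar>)"
        using ln_s by linarith
      also have "\<dots> = (\<Sum>i<N. 2 * ln s - ln \<bar>y - z i\<bar>)"
        by (simp add: sum_subtractf)
      also have "\<dots> \<le> (\<Sum>i<N. 2 * s * \<bar>y - z i\<bar> powr (-1/2))"
      proof (rule sum_mono)
        fix i assume "i \<in> {..<N}"
        then have i: "\<bar>y - z i\<bar> > 0" using u by auto
        have "2 * ln s - ln \<bar>y - z i\<bar> = 2 * ln (s * \<bar>y - z i\<bar> powr (-1/2))"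
          using i s by (simp add: ln_mult ln_powr)
        also have "\<dots> \<le> 2 * (s * \<bar>y - z i\<bar> powr (-1/2))"
          using i s by (intro mult_left_mono ln_bound) auto
        finally show "2 * ln s - ln \<bar>y - z i\<bar> \<le> 2 * s * \<bar>y - z i\<bar> powr (-1/2)" by simp
      qed
      finally have "max 0 (ln e - ln (cmod (A y))) \<le> (\<Sum>i<N. 2 * s * \<bar>y - z i\<bar> powr (-1/2))"
        using s by (auto intro!: sum_nonneg)
      then have "ennreal (max 0 (ln e - ln (cmod (A y)))) \<le> ennreal (\<Sum>i<N. 2 * s * \<bar>y - z i\<bar> powr (-1/2))"
        by (rule ennreal_leI)
      also have "\<dots> = (\<Sum>i<N. ennreal (2 * s) * ennreal (\<bar>y - z i\<bar> powr (-1/2)))"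
        using s by (subst sum_ennreal[symmetric]) (auto simp: ennreal_mult)
      finally show ?thesis using True by simp
    qed simp
  qed
  then have "(\<integral>\<^sup>+y. ennreal (max 0 (ln e - ln (cmod (A y)))) * indicator {x - l..x + l} y \<partial>lborel)
    \<le> (\<integral>\<^sup>+y. (\<Sum>i<N. ennreal (2 * s) * (ennreal (\<bar>y - z i\<bar> powr (-1/2)) * indicator {x - l..x + l} y)) \<partial>lborel)"
    by (rule nn_integral_mono_AE)
  also have "\<dots> = (\<Sum>i<N. ennreal (2 * s) * (\<integral>\<^sup>+y. ennreal (\<bar>y - z i\<bar> powr (-1/2)) * indicator {x - l..x + l} y \<partial>lborel))"
    by (subst nn_integral_sum) (auto intro!: sum.cong nn_integral_cmult)
  also have "\<dots> \<le> (\<Sum>i<N. ennreal (2 * s) * 5)"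
    by (intro sum_mono mult_left_mono nn_integral_abs_powr_neg_half l) auto
  also have "\<dots> = ennreal (10 * real N * s)"
    using s by (simp add: ennreal_of_nat_eq_real_of_nat ennreal_mult[symmetric] flip: ennreal_numeral)
  finally show ?thesis by (simp add: s_def)
qed

text \<open>Covering [-L, L] takes a number of intervals of length 2 l proportional to L, each
  contributing at most the same \<open>t e\<close>; after division by 2 L the bound is independent
  of L.\<close>

lemma uniform_tail:
  obtains \<eta> :: "real \<Rightarrow> real" where "(\<eta> \<longlongrightarrow> 0) (at_right 0)" "\<And>e. \<eta> e \<ge> 0"
    "\<And>e L. e > 0 \<Longrightarrow> L \<ge> 1 \<Longrightarrow>
      (\<integral>\<^sup>+y. ennreal (max 0 (ln e - ln (cmod (A y)))) * indicator {-L..L} y \<partial>lborel) \<le> ennreal (2 * L * \<eta> e)"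
proof -
  obtain c l :: real and N :: nat where c: "c > 0" "l > 0" "l \<le> 1 / 2" "N > 0" and
    z: "\<And>x. \<exists>z. \<forall>y\<in>{x - l..x + l}. c * (\<Prod>i<N. \<bar>y - z i\<bar>) \<le> cmod (A y)"
    using lower_bound_local by blast
  define t where "t = (\<lambda>e. 10 * real N * (e / c) powr (1 / (2 * real N)))"
  show thesis
  proof
    have "((\<lambda>e. 10 * real N * (e / c) powr (1 / (2 * real N)) / l) \<longlongrightarrow> 10 * real N * (0 / c) powr (1 / (2 * real N)) / l) (at_right 0)"
      using c by (intro tendsto_intros) (auto simp: eventually_at_filter)
    then show "((\<lambda>e. t e / l) \<longlongrightarrow> 0) (at_right 0)"
      by (simp add: t_def)
    show "t e / l \<ge> 0" for e using c by (simp add: t_def)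
    fix e L :: real assume e: "e > 0" and L: "L \<ge> 1"
    define n where "n = nat \<lceil>L / l\<rceil>"
    have n: "L / l \<le> n" "n \<le> L / l + 1" using L c by (auto simp: n_def)
    let ?J = "\<lambda>i. {(- L + (2 * real i + 1) * l) - l..(- L + (2 * real i + 1) * l) + l}"
    let ?w = "\<lambda>y. ennreal (max 0 (ln e - ln (cmod (A y))))"
    have cover: "indicator {-L..L} y \<le> (\<Sum>i<Suc n. indicator (?J i) y :: ennreal)" for y
    proof (cases "y \<in> {-L..L}")
      case True
      define i where "i = nat \<lfloor>(y + L) / (2 * l)\<rfloor>"
      have ge: "(y + L) / (2 * l) \<ge> 0" using True c by auto
      have i: "real i \<le> (y + L) / (2 * l)" "(y + L) / (2 * l) < real i + 1"
        using ge by (auto simp: i_def)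
      have "(y + L) / (2 * l) \<le> L / l" using True c by (simp add: field_simps)
      then have "i < Suc n" using i n by linarith
      moreover have "y \<in> ?J i" using i c by (auto simp: field_simps)
      ultimately have "indicator (?J i) y \<le> (\<Sum>i<Suc n. indicator (?J i) y :: ennreal)"
        by (intro member_le_sum) auto
      then show ?thesis using True \<open>y \<in> ?J i\<close> by simp
    qed simp
    have "(\<integral>\<^sup>+y. ?w y * indicator {-L..L} y \<partial>lborel) \<le> (\<integral>\<^sup>+y. (\<Sum>i<Suc n. ?w y * indicator (?J i) y) \<partial>lborel)"
      unfolding sum_distrib_left[symmetric] by (intro nn_integral_mono mult_left_mono cover) auto
    also have "\<dots> = (\<Sum>i<Suc n. \<integral>\<^sup>+y. ?w y * indicator (?J i) y \<partial>lborel)"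
      by (rule nn_integral_sum) measurable
    also have "\<dots> \<le> (\<Sum>i<Suc n. ennreal (t e))"
    proof (rule sum_mono)
      fix i
      obtain z where "\<And>y. y \<in> ?J i \<Longrightarrow> c * (\<Prod>i<N. \<bar>y - z i\<bar>) \<le> cmod (A y)"
        using z by metis
      from local_tail[OF c(1,3,4) e this] show "(\<integral>\<^sup>+y. ?w y * indicator (?J i) y \<partial>lborel) \<le> ennreal (t e)"
        by (simp add: t_def)
    qed
    also have "\<dots> = ennreal (real (Suc n) * t e)"
      using c by (simp add: t_def ennreal_of_nat_eq_real_of_nat ennreal_mult[symmetric] del: of_nat_Suc)
    also have "\<dots> \<le> ennreal (2 * L * (t e / l))"
    proof (rule ennreal_leI)
      \<comment> \<open>This absorbs the two intervals in excess of L / l; it is where L >= 1 and l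
        <= 1 / 2 enter.\<close>
      have "2 \<le> L / l" using c L by (simp add: field_simps)
      then have "real (Suc n) \<le> 2 * L / l" using n by simp
      then have "real (Suc n) * t e \<le> 2 * L / l * t e" using c by (intro mult_right_mono) (auto simp: t_def)
      then show "real (Suc n) * t e \<le> 2 * L * (t e / l)" by simp
    qed
    finally show "(\<integral>\<^sup>+y. ?w y * indicator {-L..L} y \<partial>lborel) \<le> ennreal (2 * L * (t e / l))" .
  qed
qed

end

section \<open>Means of trigonometric polynomials\<close>

lemma cis_sum: "finite S \<Longrightarrow> cis (\<Sum>j\<in>S. f j) = (\<Prod>j\<in>S. cis (f j))"
  by (induction rule: finite_induct) (auto simp: cis_mult[symmetric])

text \<open>The primitive is bounded, so means of an oscillating exponential are O(1/L).\<close>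

lemma lint_cis_le:
  assumes "\<theta> \<noteq> 0" "L \<ge> 0"
  shows "cmod (LINT y:{-L..L}|lborel. c * cis (\<theta> * y)) \<le> 2 * cmod c / \<bar>\<theta>\<bar>"
proof -
  let ?F = "\<lambda>y. c / (\<i> * of_real \<theta>) * cis (\<theta> * y)"
  have deriv: "(?F has_vector_derivative c * cis (\<theta> * y)) (at y)" for y
  proof -
    have "((\<lambda>z. c / (\<i> * of_real \<theta>) * exp (\<i> * of_real \<theta> * z)) has_field_derivative
        c * exp (\<i> * of_real \<theta> * of_real y)) (at (of_real y))"
      using assms by (auto intro!: derivative_eq_intros)
    from has_vector_derivative_real_field[OF this] show ?thesis
      by (simp add: cis_conv_exp mult_ac)
  qed
  have "(LINT y:{-L..L}|lborel. c * cis (\<theta> * y)) = ?F L - ?F (- L)"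
    unfolding set_lebesgue_integral_def
    using assms deriv
    by (intro integral_FTC_atLeastAtMost) (auto intro: has_vector_derivative_at_within intro!: continuous_intros)
  also have "cmod \<dots> \<le> cmod (?F L) + cmod (?F (- L))" by (rule norm_triangle_ineq4)
  also have "\<dots> = 2 * cmod c / \<bar>\<theta>\<bar>" by (simp add: norm_mult norm_divide)
  finally show ?thesis .
qed

text \<open>Additive generation by characters reduces statements that are linear in the function,
  such as the equality of means, to a single character.\<close>

inductive_set trigpoly :: "nat \<Rightarrow> ((nat \<Rightarrow> real) \<Rightarrow> complex) set" for d where
  monom: "(\<lambda>t. c * cis (2 * pi * (\<Sum>j<d. of_int (n j) * t j))) \<in> trigpoly d"
| add: "F \<in> trigpoly d \<Longrightarrow> G \<in> trigpoly d \<Longrightarrow> (\<lambda>t. F t + G t) \<in> trigpoly d"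

lemma trigpoly_const: "(\<lambda>t. c) \<in> trigpoly d"
  using trigpoly.monom[of c "\<lambda>j. 0" d] by simp

lemma trigpoly_sum: "finite S \<Longrightarrow> (\<And>s. s \<in> S \<Longrightarrow> F s \<in> trigpoly d) \<Longrightarrow> (\<lambda>t. \<Sum>s\<in>S. F s t) \<in> trigpoly d"
  by (induction rule: finite_induct) (auto intro: trigpoly_const trigpoly.add)

lemma trigpoly_mult:
  assumes "F \<in> trigpoly d" "G \<in> trigpoly d"
  shows "(\<lambda>t. F t * G t) \<in> trigpoly d"
  using assms
proof induction
  case (monom c n)
  then show ?case
  proof induction
    case (monom c' n')
    have "(\<lambda>t. c * cis (2 * pi * (\<Sum>j<d. of_int (n j) * t j)) * (c' * cis (2 * pi * (\<Sum>j<d. of_int (n' j) * t j)))) =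
      (\<lambda>t. c * c' * cis (2 * pi * (\<Sum>j<d. of_int (n j + n' j) * t j)))"
      by (auto simp: fun_eq_iff cis_mult[symmetric] ring_distribs sum.distrib)
    then show ?case using trigpoly.monom[of "c * c'" "\<lambda>j. n j + n' j" d] by simp
  next
    case (add F G)
    from trigpoly.add[OF add.IH] show ?case by (simp add: ring_distribs)
  qed
next
  case (add F G)
  from trigpoly.add[OF add.IH[OF add.prems]] show ?case by (simp add: ring_distribs)
qed

lemma trigpoly_cnj:
  assumes "F \<in> trigpoly d"
  shows "(\<lambda>t. cnj (F t)) \<in> trigpoly d"
  using assms
proof induction
  case (monom c n)
  have "(\<lambda>t. cnj (c * cis (2 * pi * (\<Sum>j<d. of_int (n j) * t j)))) =
      (\<lambda>t. cnj c * cis (2 * pi * (\<Sum>j<d. of_int (- n j) * t j)))"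
    by (auto simp: fun_eq_iff cis_cnj sum_negf)
  then show ?case using trigpoly.monom[of "cnj c" "\<lambda>j. - n j" d] by simp
qed (simp add: trigpoly.add)

text \<open>The reason for working with the squared modulus: it is the product of F and its
  conjugate, hence again a trigonometric polynomial.\<close>

lemma trigpoly_cmod_sq:
  assumes "F \<in> trigpoly d"
  shows "(\<lambda>t. of_real ((cmod (F t))\<^sup>2)) \<in> trigpoly d"
  using trigpoly_mult[OF assms trigpoly_cnj[OF assms]] by (simp add: complex_norm_square del: of_real_power)

lemma trigpoly_real_polynomial:
  assumes "real_polynomial_function (p :: real \<Rightarrow> real)" "(\<lambda>t. of_real (f t)) \<in> trigpoly d"
  shows "(\<lambda>t. of_real (p (f t))) \<in> trigpoly d"
  using assms(1)
proof induction
  case (linear p)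
  then obtain c where "p = (\<lambda>x. x * c)" by (auto simp: real_bounded_linear)
  then show ?case
    using trigpoly_mult[OF assms(2) trigpoly_const[of "of_real c"]] by simp
next
  case (const c)
  then show ?case by (rule trigpoly_const)
next
  case (add f g)
  then show ?case using trigpoly.add by fastforce
next
  case (mult f g)
  then show ?case using trigpoly_mult by fastforce
qed

lemma trigpoly_bounded:
  assumes "F \<in> trigpoly d"
  shows "\<exists>B. \<forall>t. cmod (F t) \<le> B"
  using assms
proof induction
  case (monom c n)
  then show ?case by (intro exI[of _ "cmod c"]) (simp add: norm_mult)
next
  case (add F G)
  then obtain B C where "\<And>t. cmod (F t) \<le> B" "\<And>t. cmod (G t) \<le> C" by blast
  then show ?case by (intro exI[of _ "B + C"] allI norm_triangle_le add_mono)
qed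

lemma trigpoly_continuous_line:
  assumes "F \<in> trigpoly d"
  shows "continuous_on S (\<lambda>y. F (\<lambda>j. r j * y))"
  using assms by induction (auto intro!: continuous_intros)

section \<open>Integration over the torus\<close>

definition torus :: "nat \<Rightarrow> (nat \<Rightarrow> real) measure" where
  "torus d = restrict_space (\<Pi>\<^sub>M j\<in>{..<d}. lborel) ({..<d} \<rightarrow>\<^sub>E {0..1})"

interpretation lborel_prod: product_sigma_finite "\<lambda>j::nat. lborel :: real measure"
  by standard

lemma box_sets: "({..<d} \<rightarrow>\<^sub>E {0..1}) \<in> sets (\<Pi>\<^sub>M j\<in>{..<d}. (lborel :: real measure))" for d :: nat
  by (intro sets_PiM_I_finite) auto

lemma box_space: "({..<d} \<rightarrow>\<^sub>E {0..1}) \<inter> space (\<Pi>\<^sub>M j\<in>{..<d}. (lborel :: real measure)) = ({..<d} \<rightarrow>\<^sub>E {0..1})" for d :: nat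
  by (auto simp: space_PiM)

lemma emeasure_torus: "emeasure (torus d) (space (torus d)) = 1"
proof -
  have "emeasure (torus d) (space (torus d)) = emeasure (\<Pi>\<^sub>M j\<in>{..<d}. lborel) ({..<d} \<rightarrow>\<^sub>E {0..1::real})"
    unfolding torus_def space_restrict_space box_space
    using box_sets by (intro emeasure_restrict_space) (auto simp: box_space)
  also have "\<dots> = (\<Prod>j<d. emeasure lborel {0..1::real})"
    by (rule lborel_prod.emeasure_PiM) auto
  finally show ?thesis by simp
qed

interpretation torus: finite_measure "torus d" for d
  by standard (simp add: emeasure_torus)

lemma measure_torus: "measure (torus d) (space (torus d)) = 1"
  by (simp add: measure_def emeasure_torus)

text \<open>Links the set integral in \<open>mahler_measure\<close> with the probability space
  \<open>torus d\<close>, where bounded measurable functions are integrable.\<close>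

lemma set_lint_torus:
  "(LINT t:({..<d} \<rightarrow>\<^sub>E {0..1}) | (\<Pi>\<^sub>M j\<in>{..<d}. lborel). f t) = (LINT t|torus d. f t)"
  for f :: "_ \<Rightarrow> 'b::{banach, second_countable_topology}"
  unfolding torus_def set_lebesgue_integral_def
  by (rule integral_restrict_space[symmetric]) (simp only: box_space box_sets)

lemma trigpoly_measurable:
  assumes "F \<in> trigpoly d"
  shows "F \<in> borel_measurable (torus d)"
  unfolding torus_def
  using assms
proof (intro measurable_restrict_space1, induction)
  case (monom c n)
  show ?case
    by (intro borel_measurable_times borel_measurable_const
        measurable_compose[OF _ borel_measurable_continuous_onI[of cis]]
        borel_measurable_sum) (auto intro!: continuous_intros)
qed simp

lemma trigpoly_integrable: "F \<in> trigpoly d \<Longrightarrow> integrable (torus d) F"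
  using trigpoly_bounded[of F d] trigpoly_measurable[of F d]
  by (auto intro!: torus.integrable_const_bound[OF AE_I2])

lemma lint_unit_cis:
  assumes "n \<noteq> 0"
  shows "(LINT x|lborel. indicator {0..1} x *\<^sub>R cis (2 * pi * of_int n * x)) = 0"
proof -
  let ?\<theta> = "2 * pi * of_int n"
  let ?F = "\<lambda>y. 1 / (\<i> * of_real ?\<theta>) * cis (?\<theta> * y)"
  have \<theta>: "complex_of_real ?\<theta> \<noteq> 0" using assms by simp
  have deriv: "(?F has_vector_derivative cis (?\<theta> * y)) (at y)" for y
  proof -
    have "((\<lambda>z. 1 / (\<i> * of_real ?\<theta>) * exp (\<i> * of_real ?\<theta> * z)) has_field_derivative
        exp (\<i> * of_real ?\<theta> * of_real y)) (at (of_real y))"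
      using \<theta> by (auto intro!: derivative_eq_intros simp del: of_real_mult)
    from has_vector_derivative_real_field[OF this] show ?thesis
      by (simp add: cis_conv_exp mult_ac)
  qed
  have "(LINT x|lborel. indicator {0..1} x *\<^sub>R cis (?\<theta> * x)) = ?F 1 - ?F 0"
    using deriv
    by (intro integral_FTC_atLeastAtMost) (auto intro: has_vector_derivative_at_within intro!: continuous_intros)
  moreover have "cis ?\<theta> = 1"
    using cis_multiple_2pi[of "of_int n"] by simp
  ultimately show ?thesis by simp
qed

text \<open>The character is a product over the coordinates, so Fubini factors the integral, and the
  factor at \<open>j0\<close> is 0.\<close>

lemma torus_lint_monom:
  assumes "j0 < d" "n j0 \<noteq> 0"
  shows "(LINT t|torus d. c * cis (2 * pi * (\<Sum>j<d. of_int (n j) * t j))) = 0"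
proof -
  have "(LINT t|torus d. cis (2 * pi * (\<Sum>j<d. of_int (n j) * t j))) =
    (LINT t|(\<Pi>\<^sub>M j\<in>{..<d}. lborel). (\<Prod>j<d. indicator {0..1} (t j) *\<^sub>R cis (2 * pi * of_int (n j) * t j)))"
    unfolding set_lint_torus[symmetric] set_lebesgue_integral_def
  proof (rule Bochner_Integration.integral_cong)
    fix t assume "t \<in> space (\<Pi>\<^sub>M j\<in>{..<d}. lborel :: real measure)"
    \<comment> \<open>Membership in the cube includes extensionality, which the product of the
      one-dimensional indicators does not see.\<close>
    then have ext: "t \<in> extensional {..<d}" by (simp add: space_PiM PiE_def)
    have "cis (2 * pi * (\<Sum>j<d. of_int (n j) * t j)) = (\<Prod>j<d. cis (2 * pi * of_int (n j) * t j))"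
      by (simp only: cis_sum[OF finite_lessThan, symmetric] sum_distrib_left mult.assoc)
    moreover have "(indicator ({..<d} \<rightarrow>\<^sub>E {0..1}) t :: real) = (\<Prod>j<d. indicator {0..1} (t j))"
    proof -
      have mem: "t \<in> {..<d} \<rightarrow>\<^sub>E {0..1} \<longleftrightarrow> (\<forall>j<d. t j \<in> {0..1})"
        using ext by (auto simp only: PiE_iff lessThan_iff)
      show ?thesis
      proof (cases "\<forall>j<d. t j \<in> {0..1}")
        case True
        then have "(\<Prod>j<d. indicator {0..1} (t j) :: real) = (\<Prod>j<d. 1)"
          by (intro prod.cong) auto
        then show ?thesis using True mem by (simp only: indicator_simps prod.neutral_const)
      next
        case False
        then obtain j where "j < d" "t j \<notin> {0..1}" by blast
        then have "(\<Prod>j<d. indicator {0..1} (t j) :: real) = 0"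
          by (intro prod_zero) (auto intro!: bexI[of _ j])
        then show ?thesis using False mem by (simp add: indicator_def)
      qed
    qed
    ultimately show "indicator ({..<d} \<rightarrow>\<^sub>E {0..1}) t *\<^sub>R cis (2 * pi * (\<Sum>j<d. of_int (n j) * t j)) =
        (\<Prod>j<d. indicator {0..1} (t j) *\<^sub>R cis (2 * pi * of_int (n j) * t j))"
      by (simp add: prod.distrib scaleR_conv_of_real)
  qed simp
  also have "\<dots> = (\<Prod>j<d. (LINT x|lborel. indicator {0..1} x *\<^sub>R cis (2 * pi * of_int (n j) * x)))"
    by (intro lborel_prod.product_integral_prod borel_integrable_compact) (auto intro!: continuous_intros)
  also have "\<dots> = 0"
    using assms lint_unit_cis by (intro prod_zero) auto
  finally show ?thesis by simp
qed

section \<open>Means along a line with rationally independent slopes\<close>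

interpretation real_rat: vector_space "\<lambda>(q::rat) (x::real). of_rat q * x"
  by standard (auto simp: algebra_simps of_rat_add of_rat_mult)

text \<open>Independence concerns the set of values of r; injectivity transfers the coefficients
  from indices to values.\<close>

lemma rat_independent_int_comb:
  fixes r :: "nat \<Rightarrow> real"
  assumes "rat_independent (r ` {..<d})" "inj_on r {..<d}" "(\<Sum>j<d. of_int (n j) * r j) = 0" "j < d"
  shows "n j = 0"
proof -
  let ?u = "\<lambda>v. rat_of_int (n (inv_into {..<d} r v))"
  have "(\<Sum>v\<in>r ` {..<d}. of_rat (?u v) * v) = (\<Sum>j<d. of_int (n j) * r j)"
    using assms(2) by (simp add: sum.reindex)
  then have "?u (r j) = 0"
    using assms by (intro real_rat.independentD[OF assms(1), where t = "r ` {..<d}"]) auto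
  then show ?thesis using assms by simp
qed

lemma set_lint_add:
  fixes a b :: real
  assumes "continuous_on {a..b} f" "continuous_on {a..b} g"
  shows "(LINT y:{a..b}|lborel. f y + g y :: complex) = (LINT y:{a..b}|lborel. f y) + (LINT y:{a..b}|lborel. g y)"
  by (rule set_integral_add(2)[OF assms[THEN borel_integrable_atLeastAtMost']])

text \<open>By independence a nontrivial character keeps a nonzero frequency \<theta> on the line,
  so its mean is 0 there as on the torus; the trivial character is constant on both.\<close>

lemma trigpoly_mean:
  assumes F: "F \<in> trigpoly d" and r: "rat_independent (r ` {..<d})" "inj_on r {..<d}"
  shows "((\<lambda>L. (LINT y:{-L..L}|lborel. F (\<lambda>j. r j * y)) / of_real (2 * L)) \<longlongrightarrow> (LINT t|torus d. F t)) at_top"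
  using F
proof induction
  case (monom c n)
  show ?case
  proof (cases "\<forall>j<d. n j = 0")
    case True
    then have "((\<lambda>L. c) \<longlongrightarrow> c) at_top" by simp
    moreover have "\<forall>\<^sub>F L in at_top. c = (LINT y:{-L..L}|lborel. c) / of_real (2 * L)"
      using eventually_gt_at_top[of "0::real"]
      by eventually_elim (simp add: set_lebesgue_integral_def scaleR_conv_of_real)
    ultimately have "((\<lambda>L. (LINT y:{-L..L}|lborel. c) / of_real (2 * L)) \<longlongrightarrow> c) at_top"
      by (rule Lim_transform_eventually)
    then show ?thesis using True by (simp add: measure_torus)
  next
    case False
    then obtain j0 where j0: "j0 < d" "n j0 \<noteq> 0" by auto
    define \<theta> where "\<theta> = 2 * pi * (\<Sum>j<d. of_int (n j) * r j)"
    have \<theta>: "\<theta> \<noteq> 0"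
      using rat_independent_int_comb[OF r, of n j0] j0 by (auto simp: \<theta>_def)
    have eq: "2 * pi * (\<Sum>j<d. of_int (n j) * (r j * y)) = \<theta> * y" for y
      by (simp add: \<theta>_def sum_distrib_left sum_distrib_right mult_ac)
    have "((\<lambda>L. (LINT y:{-L..L}|lborel. c * cis (\<theta> * y)) / of_real (2 * L)) \<longlongrightarrow> 0) at_top"
    proof (rule Lim_null_comparison)
      show "\<forall>\<^sub>F L in at_top. cmod ((LINT y:{-L..L}|lborel. c * cis (\<theta> * y)) / of_real (2 * L)) \<le> cmod c / \<bar>\<theta>\<bar> / L"
        using eventually_gt_at_top[of "0::real"]
      proof eventually_elim
        case (elim L)
        then show ?case using lint_cis_le[OF \<theta>, of L c] by (simp add: norm_divide divide_right_mono field_simps)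
      qed
      show "((\<lambda>L. cmod c / \<bar>\<theta>\<bar> / L) \<longlongrightarrow> 0) at_top"
        by (intro tendsto_divide_0[OF tendsto_const] filterlim_at_top_imp_at_infinity filterlim_ident)
    qed
    then show ?thesis unfolding eq torus_lint_monom[of j0 d n, OF j0] .
  qed
next
  case (add F G)
  have "(LINT y:{-L..L}|lborel. F (\<lambda>j. r j * y) + G (\<lambda>j. r j * y)) =
      (LINT y:{-L..L}|lborel. F (\<lambda>j. r j * y)) + (LINT y:{-L..L}|lborel. G (\<lambda>j. r j * y))" for L
    by (rule set_lint_add[OF add.hyps[THEN trigpoly_continuous_line]])
  moreover have "(LINT t|torus d. F t + G t) = (LINT t|torus d. F t) + (LINT t|torus d. G t)"
    by (rule Bochner_Integration.integral_add[OF add.hyps[THEN trigpoly_integrable]])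
  ultimately show ?case
    using tendsto_add[OF add.IH] by (simp add: add_divide_distrib)
qed

lemma mean_diff_le:
  fixes f g :: "real \<Rightarrow> real"
  assumes "set_integrable lborel {-L..L} f" "set_integrable lborel {-L..L} g" "L > 0"
    "\<And>y. y \<in> {-L..L} \<Longrightarrow> \<bar>f y - g y\<bar> \<le> e"
  shows "\<bar>(LINT y:{-L..L}|lborel. f y) / (2 * L) - (LINT y:{-L..L}|lborel. g y) / (2 * L)\<bar> \<le> e"
proof -
  have "(LINT y:{-L..L}|lborel. f y) - (LINT y:{-L..L}|lborel. g y) = (LINT y:{-L..L}|lborel. f y - g y)"
    by (rule set_integral_diff(2)[OF assms(1,2), symmetric])
  moreover have "f y - g y \<le> e" "- e \<le> f y - g y" if "y \<in> {-L..L}" for y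
    using assms(4)[OF that] by linarith+
  then have "(LINT y:{-L..L}|lborel. f y - g y) \<le> (LINT y:{-L..L}|lborel. e)"
    "(LINT y:{-L..L}|lborel. - e) \<le> (LINT y:{-L..L}|lborel. f y - g y)"
    by (intro set_integral_mono set_integral_diff assms borel_integrable_atLeastAtMost' continuous_on_const; blast)+
  moreover have "(LINT y:{-L..L}|lborel. c) = 2 * L * c" for c :: real
    using assms(3) by (simp add: set_lebesgue_integral_def)
  ultimately have "\<bar>(LINT y:{-L..L}|lborel. f y) - (LINT y:{-L..L}|lborel. g y)\<bar> \<le> 2 * L * e"
    by auto
  then show ?thesis using assms(3) by (simp add: diff_divide_distrib[symmetric] abs_divide divide_le_eq mult.commute)
qed

text \<open>
  By Weierstrass it suffices to treat \<open>\<Phi>\<close> a polynomial, and then the integrand is again a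
  trigonometric polynomial.
\<close>

lemma continuous_mean:
  assumes F: "F \<in> trigpoly d" and r: "rat_independent (r ` {..<d})" "inj_on r {..<d}"
    and \<Phi>: "continuous_on UNIV (\<Phi> :: real \<Rightarrow> real)"
  shows "((\<lambda>L. (LINT y:{-L..L}|lborel. \<Phi> ((cmod (F (\<lambda>j. r j * y)))\<^sup>2)) / (2 * L)) \<longlongrightarrow>
      (LINT t|torus d. \<Phi> ((cmod (F t))\<^sup>2))) at_top" (is "(?m \<Phi> \<longlongrightarrow> ?I \<Phi>) at_top")
proof (rule tendstoI)
  fix e :: real assume e: "e > 0"
  obtain B where B: "\<And>t. cmod (F t) \<le> B" using trigpoly_bounded[OF F] by blast
  \<comment> \<open>The values stay in a compact interval, the one on which Weierstrass
    approximation takes place.\<close>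
  have sq: "(cmod (F t))\<^sup>2 \<in> {0..B\<^sup>2}" for t using B[of t] by (auto intro: power_mono)
  obtain p where p: "real_polynomial_function p" "\<And>x. x \<in> {0..B\<^sup>2} \<Longrightarrow> \<bar>\<Phi> x - p x\<bar> < e / 3"
    by (rule Stone_Weierstrass_real_polynomial_function[of "{0..B\<^sup>2}" \<Phi> "e/3"])
      (use e \<Phi> in \<open>auto intro: continuous_on_subset\<close>)
  have pc: "continuous_on UNIV p"
    using p(1) by (simp add: continuous_at_imp_continuous_on continuous_real_polymonial_function)
  have tp: "(\<lambda>t. of_real (p ((cmod (F t))\<^sup>2))) \<in> trigpoly d"
    by (rule trigpoly_real_polynomial[OF p(1) trigpoly_cmod_sq[OF F]])
  have "((\<lambda>L. of_real (?m p L)) \<longlongrightarrow> complex_of_real (?I p)) at_top"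
    using trigpoly_mean[OF tp r] by (simp add: set_integral_complex_of_real)
  then have "(?m p \<longlongrightarrow> ?I p) at_top"
    by (simp only: tendsto_of_real_iff)
  then have "\<forall>\<^sub>F L in at_top. dist (?m p L) (?I p) < e / 3"
    using e by (intro tendstoD) auto
  then show "\<forall>\<^sub>F L in at_top. dist (?m \<Phi> L) (?I \<Phi>) < e"
    using eventually_gt_at_top[of "0::real"]
  proof eventually_elim
    case (elim L)
    have int: "set_integrable lborel {-L..L} (\<lambda>y. \<Psi> ((cmod (F (\<lambda>j. r j * y)))\<^sup>2))" if "continuous_on UNIV \<Psi>" for \<Psi> :: "real \<Rightarrow> real"
      by (intro borel_integrable_atLeastAtMost' continuous_on_compose2[OF that] continuous_intros trigpoly_continuous_line[OF F]) auto
    have "\<bar>?m \<Phi> L - ?m p L\<bar> \<le> e / 3"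
      using p(2)[OF sq] less_imp_le by (intro mean_diff_le int \<Phi> pc elim) blast
    moreover have "\<bar>?I \<Phi> - ?I p\<bar> \<le> e / 3"
    proof -
      have Fm: "F \<in> borel_measurable (torus d)" by (rule trigpoly_measurable[OF F])
      have ip: "integrable (torus d) (\<lambda>t. p ((cmod (F t))\<^sup>2))"
        using trigpoly_integrable[OF tp] by (simp only: complex_of_real_integrable_eq)
      have m\<Phi>: "(\<lambda>t. \<Phi> ((cmod (F t))\<^sup>2)) \<in> borel_measurable (torus d)"
        using Fm by (intro measurable_compose[OF _ borel_measurable_continuous_onI[OF \<Phi>]]) measurable
      have diff: "integrable (torus d) (\<lambda>t. \<Phi> ((cmod (F t))\<^sup>2) - p ((cmod (F t))\<^sup>2))"
        using m\<Phi> ip p(2)[OF sq] less_imp_le by (intro torus.integrable_const_bound[where B = "e/3"]) auto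
      then have "integrable (torus d) (\<lambda>t. \<Phi> ((cmod (F t))\<^sup>2) - p ((cmod (F t))\<^sup>2) + p ((cmod (F t))\<^sup>2))"
        using ip by (rule Bochner_Integration.integrable_add)
      then have i\<Phi>: "integrable (torus d) (\<lambda>t. \<Phi> ((cmod (F t))\<^sup>2))" by simp
      have "?I \<Phi> - ?I p = (LINT t|torus d. \<Phi> ((cmod (F t))\<^sup>2) - p ((cmod (F t))\<^sup>2))"
        by (rule Bochner_Integration.integral_diff[OF i\<Phi> ip, symmetric])
      also have "\<bar>\<dots>\<bar> \<le> (LINT t|torus d. \<bar>\<Phi> ((cmod (F t))\<^sup>2) - p ((cmod (F t))\<^sup>2)\<bar>)"
        by (rule integral_abs_bound)
      also have "\<dots> \<le> (LINT t|torus d. e / 3)"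
        using p(2)[OF sq] less_imp_le by (intro integral_mono integrable_abs diff) auto
      finally show ?thesis by (simp add: measure_torus)
    qed
    ultimately show ?case using elim unfolding dist_real_def by linarith
  qed
qed

section \<open>The mean of the logarithm of an exponential sum\<close>

text \<open>Made for squared moduli: at x = |w|^2 it is ln (max |w| e), whence the square of e and
  the factor 1/2.\<close>

definition trunc_ln :: "real \<Rightarrow> real \<Rightarrow> real" where
  "trunc_ln e x = ln (max x (e\<^sup>2)) / 2"

lemma trunc_ln_continuous: "e > 0 \<Longrightarrow> continuous_on UNIV (trunc_ln e)"
  unfolding trunc_ln_def[abs_def] by (intro continuous_intros) (auto simp: max_def)

lemma trunc_ln_mono: "0 < d \<Longrightarrow> d \<le> e \<Longrightarrow> trunc_ln d x \<le> trunc_ln e x"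
  unfolding trunc_ln_def by (intro divide_right_mono ln_mono max.mono power_mono) (auto simp: less_max_iff_disj)

lemma trunc_ln_square:
  assumes "x > 0" "e > 0"
  shows "trunc_ln e (x\<^sup>2) = ln x + max 0 (ln e - ln x)"
proof (cases "x \<le> e")
  case True
  then have "max (x\<^sup>2) (e\<^sup>2) = e\<^sup>2" using assms by (intro max_absorb2 power_mono) auto
  then show ?thesis using True assms by (simp add: trunc_ln_def ln_realpow)
next
  case False
  then have "max (x\<^sup>2) (e\<^sup>2) = x\<^sup>2" using assms by (intro max_absorb1 power_mono) auto
  then show ?thesis using False assms by (simp add: trunc_ln_def ln_realpow)
qed

lemma trunc_ln_0: "e > 0 \<Longrightarrow> trunc_ln e 0 = ln e"
  by (simp add: trunc_ln_def ln_realpow max_absorb2)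

context exp_sum
begin

lemma AE_trunc_ln:
  assumes "e > 0"
  shows "AE y in lborel. ln (cmod (A y)) = trunc_ln e ((cmod (A y))\<^sup>2) - max 0 (ln e - ln (cmod (A y)))"
  using AE_nonzero by eventually_elim (simp add: trunc_ln_square assms)

lemma trunc_ln_integrable:
  "e > 0 \<Longrightarrow> set_integrable lborel {-L..L} (\<lambda>y. trunc_ln e ((cmod (A y))\<^sup>2))"
  by (intro borel_integrable_atLeastAtMost' continuous_on_compose2[OF trunc_ln_continuous]
      continuous_intros A_continuous) auto

text \<open>Off the zeros of A, ln |A| is its truncation minus a nonnegative tail. By
  \<open>uniform_tail\<close> the tail is integrable with mean at most \<eta> e, which gives both
  claims.\<close>

lemma ln_integrable: "set_integrable lborel {-L..L} (\<lambda>y. ln (cmod (A y)))"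
  and trunc_error: "\<exists>\<eta>. (\<eta> \<longlongrightarrow> 0) (at_right (0::real)) \<and>
    (\<forall>e>0. \<forall>L\<ge>1. (LINT y:{-L..L}|lborel. ln (cmod (A y))) / (2 * L) \<le> (LINT y:{-L..L}|lborel. trunc_ln e ((cmod (A y))\<^sup>2)) / (2 * L)
      \<and> (LINT y:{-L..L}|lborel. trunc_ln e ((cmod (A y))\<^sup>2)) / (2 * L) - \<eta> e \<le> (LINT y:{-L..L}|lborel. ln (cmod (A y))) / (2 * L))"
proof -
  obtain \<eta> :: "real \<Rightarrow> real" where \<eta>: "(\<eta> \<longlongrightarrow> 0) (at_right 0)" "\<And>e. \<eta> e \<ge> 0" and
    tail: "\<And>e L. e > 0 \<Longrightarrow> L \<ge> 1 \<Longrightarrow>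
      (\<integral>\<^sup>+y. ennreal (max 0 (ln e - ln (cmod (A y)))) * indicator {-L..L} y \<partial>lborel) \<le> ennreal (2 * L * \<eta> e)"
    using uniform_tail by blast
  let ?w = "\<lambda>e y. max 0 (ln e - ln (cmod (A y)))"
  have w: "set_integrable lborel {-L..L} (?w e)" "(LINT y:{-L..L}|lborel. ?w e y) \<le> 2 * L * \<eta> e"
    "0 \<le> (LINT y:{-L..L}|lborel. ?w e y)"
    if "e > 0" "L \<ge> 1" for e L
  proof -
    have nn: "(\<integral>\<^sup>+y. ennreal (indicator {-L..L} y *\<^sub>R ?w e y) \<partial>lborel) \<le> ennreal (2 * L * \<eta> e)"
      using tail[OF that] by (simp add: mult.commute ennreal_mult'' ennreal_indicator[symmetric])
    have int: "integrable lborel (\<lambda>y. indicator {-L..L} y *\<^sub>R ?w e y)"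
      using le_less_trans[OF nn ennreal_less_top] by (intro integrableI_nonneg) auto
    then show "set_integrable lborel {-L..L} (?w e)" by (simp add: set_integrable_def)
    have "ennreal (LINT y|lborel. indicator {-L..L} y *\<^sub>R ?w e y) = (\<integral>\<^sup>+y. ennreal (indicator {-L..L} y *\<^sub>R ?w e y) \<partial>lborel)"
      by (rule nn_integral_eq_integral[OF int, symmetric]) auto
    with nn have "ennreal (LINT y|lborel. indicator {-L..L} y *\<^sub>R ?w e y) \<le> ennreal (2 * L * \<eta> e)"
      by (simp only:)
    moreover have "0 \<le> 2 * L * \<eta> e" using \<eta>(2)[of e] that by simp
    ultimately show "(LINT y:{-L..L}|lborel. ?w e y) \<le> 2 * L * \<eta> e"
      unfolding set_lebesgue_integral_def by (simp only: ennreal_le_iff)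
    show "0 \<le> (LINT y:{-L..L}|lborel. ?w e y)"
      unfolding set_lebesgue_integral_def by (intro Bochner_Integration.integral_nonneg) auto
  qed
  have lnw: "set_integrable lborel {-L..L} (\<lambda>y. ln (cmod (A y)))"
    "(LINT y:{-L..L}|lborel. ln (cmod (A y))) =
      (LINT y:{-L..L}|lborel. trunc_ln e ((cmod (A y))\<^sup>2)) - (LINT y:{-L..L}|lborel. ?w e y)"
    if "e > 0" "L \<ge> 1" for e L
  proof -
    have int: "set_integrable lborel {-L..L} (\<lambda>y. trunc_ln e ((cmod (A y))\<^sup>2) - ?w e y)"
      by (intro set_integral_diff trunc_ln_integrable w that)
    have ae: "AE y in lborel. indicator {-L..L} y *\<^sub>R ln (cmod (A y)) =
        indicator {-L..L} y *\<^sub>R (trunc_ln e ((cmod (A y))\<^sup>2) - ?w e y)"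
      using AE_trunc_ln[OF that(1)] by eventually_elim simp
    show "set_integrable lborel {-L..L} (\<lambda>y. ln (cmod (A y)))"
      using int unfolding set_integrable_def
      by (subst integrable_cong_AE[OF _ _ ae]) (auto dest: borel_measurable_integrable)
    have "(LINT y:{-L..L}|lborel. ln (cmod (A y))) = (LINT y:{-L..L}|lborel. trunc_ln e ((cmod (A y))\<^sup>2) - ?w e y)"
      unfolding set_lebesgue_integral_def
      using int unfolding set_integrable_def
      by (intro integral_cong_AE ae) (auto dest: borel_measurable_integrable)
    also have "\<dots> = (LINT y:{-L..L}|lborel. trunc_ln e ((cmod (A y))\<^sup>2)) - (LINT y:{-L..L}|lborel. ?w e y)"
      by (intro set_integral_diff trunc_ln_integrable w that)
    finally show "(LINT y:{-L..L}|lborel. ln (cmod (A y))) =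
      (LINT y:{-L..L}|lborel. trunc_ln e ((cmod (A y))\<^sup>2)) - (LINT y:{-L..L}|lborel. ?w e y)" .
  qed
  show "set_integrable lborel {-L..L} (\<lambda>y. ln (cmod (A y)))"
    \<comment> \<open>The tail bound is for L >= 1; a shorter interval is contained in such a
      one.\<close>
    by (rule set_integrable_subset[OF lnw(1)[of 1 "max 1 L"]]) auto
  show "\<exists>\<eta>. (\<eta> \<longlongrightarrow> 0) (at_right (0::real)) \<and>
    (\<forall>e>0. \<forall>L\<ge>1. (LINT y:{-L..L}|lborel. ln (cmod (A y))) / (2 * L) \<le> (LINT y:{-L..L}|lborel. trunc_ln e ((cmod (A y))\<^sup>2)) / (2 * L)
      \<and> (LINT y:{-L..L}|lborel. trunc_ln e ((cmod (A y))\<^sup>2)) / (2 * L) - \<eta> e \<le> (LINT y:{-L..L}|lborel. ln (cmod (A y))) / (2 * L))"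
  proof (intro exI[of _ \<eta>] conjI allI impI \<eta>(1))
    fix e L :: real assume eL: "e > 0" "L \<ge> 1"
    show "(LINT y:{-L..L}|lborel. ln (cmod (A y))) / (2 * L) \<le> (LINT y:{-L..L}|lborel. trunc_ln e ((cmod (A y))\<^sup>2)) / (2 * L)"
      using eL w(3)[OF eL] by (intro divide_right_mono) (auto simp: lnw(2)[OF eL])
    have "(LINT y:{-L..L}|lborel. ?w e y) / (2 * L) \<le> \<eta> e"
      using w(2)[OF eL] eL by (simp add: divide_le_eq mult.commute)
    then show "(LINT y:{-L..L}|lborel. trunc_ln e ((cmod (A y))\<^sup>2)) / (2 * L) - \<eta> e \<le> (LINT y:{-L..L}|lborel. ln (cmod (A y))) / (2 * L)"
      unfolding lnw(2)[OF eL] diff_divide_distrib by linarith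
  qed
qed

text \<open>
  The truncated logarithm is continuous, so that its means converge; the means over the line also
  control the truncation error on the torus.
\<close>

lemma mean_ln:
  assumes F: "F \<in> trigpoly d" and r: "rat_independent (r ` {..<d})" "inj_on r {..<d}"
    and AF: "\<And>y. A y = F (\<lambda>j. r j * y)"
  shows "((\<lambda>L. (LINT y:{-L..L}|lborel. ln (cmod (A y))) / (2 * L)) \<longlongrightarrow> (LINT t|torus d. ln (cmod (F t)))) at_top"
proof -
  define l where "l = (\<lambda>L. (LINT y:{-L..L}|lborel. ln (cmod (A y))) / (2 * L))"
  define m where "m = (\<lambda>e L. (LINT y:{-L..L}|lborel. trunc_ln e ((cmod (A y))\<^sup>2)) / (2 * L))"
  define T where "T = (\<lambda>e. LINT t|torus d. trunc_ln e ((cmod (F t))\<^sup>2))"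
  obtain \<eta> :: "real \<Rightarrow> real" where \<eta>: "(\<eta> \<longlongrightarrow> 0) (at_right 0)" and
    err: "\<And>e L. e > 0 \<Longrightarrow> L \<ge> 1 \<Longrightarrow> l L \<le> m e L" "\<And>e L. e > 0 \<Longrightarrow> L \<ge> 1 \<Longrightarrow> m e L - \<eta> e \<le> l L"
    using trunc_error unfolding l_def m_def by metis
  have mT: "(m e \<longlongrightarrow> T e) at_top" if "e > 0" for e
    unfolding m_def T_def AF by (rule continuous_mean[OF F r trunc_ln_continuous[OF that]])
  have [measurable]: "F \<in> borel_measurable (torus d)" by (rule trigpoly_measurable[OF F])
  have int: "integrable (torus d) (\<lambda>t. trunc_ln e ((cmod (F t))\<^sup>2))" if "e > 0" for e
  proof -
    obtain B where B: "\<And>t. cmod (F t) \<le> B" using trigpoly_bounded[OF F] by blast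
    have "compact (trunc_ln e ` {0..B\<^sup>2})"
      by (intro compact_continuous_image continuous_on_subset[OF trunc_ln_continuous[OF that]]) auto
    then obtain C where C: "\<And>x. x \<in> {0..B\<^sup>2} \<Longrightarrow> \<bar>trunc_ln e x\<bar> \<le> C"
      using compact_imp_bounded by (force simp: bounded_real)
    have "(cmod (F t))\<^sup>2 \<in> {0..B\<^sup>2}" for t using B[of t] by (auto intro: power_mono)
    then show ?thesis
      using C by (intro torus.integrable_const_bound[where B = C] measurable_compose[OF _ borel_measurable_continuous_onI[OF trunc_ln_continuous[OF that]]]) auto
  qed
  have Tmono: "T e \<le> T e'" if "0 < e" "e \<le> e'" for e e'
    unfolding T_def using that by (intro integral_mono int trunc_ln_mono) auto
  \<comment> \<open>For every L >= 1, m e L - m e' L <= m e L - l L <= \<eta> e; the bound, free of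
    e', survives the limit in L.\<close>
  have Tdiff: "T e - T e' \<le> \<eta> e" if "0 < e" "0 < e'" for e e'
  proof (rule tendsto_upperbound)
    show "((\<lambda>L. m e L - m e' L) \<longlongrightarrow> T e - T e') at_top"
      by (intro tendsto_diff mT that)
    show "\<forall>\<^sub>F L in at_top. m e L - m e' L \<le> \<eta> e"
      using eventually_ge_at_top[of 1]
    proof eventually_elim
      case (elim L)
      then show ?case using err(1)[OF that(2) elim] err(2)[OF that(1) elim] by linarith
    qed
  qed simp
  define Z where "Z = {t \<in> space (torus d). F t = 0}"
  have Zs: "Z \<in> sets (torus d)" unfolding Z_def by measurable
  have "measure (torus d) Z = 0"
  proof (rule ccontr)
    assume "measure (torus d) Z \<noteq> 0"
    then have pos: "measure (torus d) Z > 0" by (simp add: zero_less_measure_iff)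
    \<comment> \<open>Lowering the truncation from 1 to exp (-k) costs k on Z, so at least |\<eta>
      1| + 1 in total, more than \<open>Tdiff\<close> permits.\<close>
    define k where "k = (\<bar>\<eta> 1\<bar> + 1) / measure (torus d) Z"
    have k: "k > 0" using pos by (auto simp: k_def intro!: divide_pos_pos add_nonneg_pos)
    have "k * measure (torus d) Z = (LINT t|torus d. k * indicator Z t)"
      using Zs by (simp add: Int_absorb1 sets.sets_into_space)
    also have "\<dots> \<le> (LINT t|torus d. trunc_ln 1 ((cmod (F t))\<^sup>2) - trunc_ln (exp (- k)) ((cmod (F t))\<^sup>2))"
    proof (intro integral_mono Bochner_Integration.integrable_diff int)
      show "integrable (torus d) (\<lambda>t. k * indicator Z t)"
        using Zs by (auto simp: torus.emeasure_eq_measure)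
      show "k * indicator Z t \<le> trunc_ln 1 ((cmod (F t))\<^sup>2) - trunc_ln (exp (- k)) ((cmod (F t))\<^sup>2)" for t
      proof (cases "t \<in> Z")
        case True
        then show ?thesis by (simp add: Z_def trunc_ln_0)
      next
        case False
        then show ?thesis using trunc_ln_mono[of "exp (- k)" 1] k by simp
      qed
    qed auto
    also have "\<dots> = T 1 - T (exp (- k))"
      unfolding T_def by (intro Bochner_Integration.integral_diff int) auto
    also have "\<dots> \<le> \<eta> 1" by (rule Tdiff) auto
    finally show False using pos by (simp add: k_def)
  qed
  then have "AE t in torus d. t \<notin> Z"
    using Zs by (intro AE_not_in) (auto simp: null_sets_def torus.emeasure_eq_measure)
  then have nz: "AE t in torus d. F t \<noteq> 0"
    using AE_space by eventually_elim (auto simp: Z_def)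
  define e where "e = (\<lambda>n. 1 / real (Suc n))"
  have e: "e n > 0" "e (Suc n) \<le> e n" for n by (auto simp: e_def field_simps)
  have e_lim: "e \<longlonglongrightarrow> 0" unfolding e_def using LIMSEQ_Suc[OF lim_1_over_n] by simp
  have e_dec: "e n \<le> e k" if "k \<le> n" for n k
    using that by (auto simp: e_def intro: divide_left_mono)
  have "convergent (\<lambda>n. - T (e n))"
  proof -
    have inc: "- T (e k) \<le> - T (e n)" if "k \<le> n" for k n
      using Tmono[OF e(1) e_dec[OF that]] by simp
    have "\<bar>- T (e n)\<bar> \<le> \<bar>T (e 0)\<bar> + \<bar>\<eta> (e 0)\<bar>" for n
      using Tdiff[OF e(1) e(1), of 0 n] inc[of 0 n] by linarith
    then have "Bseq (\<lambda>n. - T (e n))"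
      by (intro BseqI') auto
    then show ?thesis
      by (rule Bseq_mono_convergent) (use inc in blast)
  qed
  then obtain x where x: "(\<lambda>n. - T (e n)) \<longlonglongrightarrow> x" by (auto simp: convergent_def)
  \<comment> \<open>Negated truncations increase as \<open>e n\<close> decreases to 0, which is the
    direction that monotone convergence asks for.\<close>
  have "(LINT t|torus d. - ln (cmod (F t))) = x"
  proof (rule integral_monotone_convergence)
    show "integrable (torus d) (\<lambda>t. - trunc_ln (e n) ((cmod (F t))\<^sup>2))" for n
      by (intro Bochner_Integration.integrable_minus int e)
    show "AE t in torus d. mono (\<lambda>n. - trunc_ln (e n) ((cmod (F t))\<^sup>2))"
      by (auto intro!: AE_I2 monoI trunc_ln_mono e e_dec)
    show "AE t in torus d. (\<lambda>n. - trunc_ln (e n) ((cmod (F t))\<^sup>2)) \<longlonglongrightarrow> - ln (cmod (F t))"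
      using nz
    proof eventually_elim
      case (elim t)
      have "\<forall>\<^sub>F n in sequentially. e n < cmod (F t)"
        using order_tendstoD(2)[OF e_lim, of "cmod (F t)"] elim by simp
      then have "\<forall>\<^sub>F n in sequentially. - ln (cmod (F t)) = - trunc_ln (e n) ((cmod (F t))\<^sup>2)"
      proof eventually_elim
        case (elim n)
        then have "ln (e n) \<le> ln (cmod (F t))" using e(1)[of n] by (intro ln_mono) auto
        then show ?case using \<open>F t \<noteq> 0\<close> e(1)[of n] by (simp add: trunc_ln_square)
      qed
      then show ?case by (rule Lim_transform_eventually[OF tendsto_const])
    qed
    show "(\<lambda>n. LINT t|torus d. - trunc_ln (e n) ((cmod (F t))\<^sup>2)) \<longlonglongrightarrow> x"
      using x by (simp add: T_def)
    show "(\<lambda>t. - ln (cmod (F t))) \<in> borel_measurable (torus d)" by measurable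
  qed
  then have T0: "(\<lambda>n. T (e n)) \<longlonglongrightarrow> (LINT t|torus d. ln (cmod (F t)))" (is "_ \<longlonglongrightarrow> ?T0")
    using tendsto_minus[OF x] by auto
  \<comment> \<open>The limit of \<open>Tdiff\<close> as the second level tends to 0: the error
    bound from the line now holds on the torus.\<close>
  have T0_bd: "?T0 \<le> T (e n)" "T (e n) - \<eta> (e n) \<le> ?T0" for n
  proof -
    show "?T0 \<le> T (e n)"
      by (rule tendsto_upperbound[OF T0]) (auto intro!: eventually_sequentiallyI[of n] Tmono e e_dec)
    show "T (e n) - \<eta> (e n) \<le> ?T0"
      by (rule tendsto_lowerbound[OF T0]) (use Tdiff[OF e(1) e(1), of n] in \<open>auto simp: algebra_simps\<close>)
  qed
  have "(l \<longlongrightarrow> ?T0) at_top"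
  proof (rule tendstoI)
    fix \<epsilon> :: real assume \<epsilon>: "\<epsilon> > 0"
    have "filterlim e (at_right 0) sequentially"
      unfolding filterlim_at using e_lim by (auto intro!: always_eventually simp: e_def)
    from filterlim_compose[OF \<eta> this] have "(\<lambda>n. \<eta> (e n)) \<longlonglongrightarrow> 0" .
    then have "\<forall>\<^sub>F n in sequentially. \<eta> (e n) < \<epsilon> / 3"
      using \<epsilon> by (intro order_tendstoD) auto
    then obtain n where n: "\<eta> (e n) < \<epsilon> / 3" by (auto simp: eventually_sequentially)
    have "\<forall>\<^sub>F L in at_top. dist (m (e n) L) (T (e n)) < \<epsilon> / 3"
      using mT[OF e(1)] \<epsilon> by (intro tendstoD) auto
    then show "\<forall>\<^sub>F L in at_top. dist (l L) ?T0 < \<epsilon>"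
      using eventually_ge_at_top[of 1]
    proof eventually_elim
      case (elim L)
      then show ?case
        using err[OF e(1)[of n] elim(2)] T0_bd[of n] n unfolding dist_real_def by linarith
    qed
  qed
  then show ?thesis by (simp add: l_def)
qed

end

section \<open>Laurent polynomial representations\<close>

lemma laurent_eval_trigpoly:
  assumes "in_vars d P"
  shows "(\<lambda>t. laurent_eval P (\<lambda>j. cis (2 * pi * t j))) \<in> trigpoly d"
proof -
  have "(\<Prod>j\<in>Poly_Mapping.keys k. cis (2 * pi * t j) powi Poly_Mapping.lookup k j) =
      cis (2 * pi * (\<Sum>j<d. of_int (Poly_Mapping.lookup k j) * t j))" if "k \<in> Poly_Mapping.keys P" for k t
  proof -
    have sub: "Poly_Mapping.keys k \<subseteq> {..<d}" using assms that by (simp add: in_vars_def)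
    have "(\<Prod>j\<in>Poly_Mapping.keys k. cis (2 * pi * t j) powi Poly_Mapping.lookup k j) =
        cis (\<Sum>j\<in>Poly_Mapping.keys k. of_int (Poly_Mapping.lookup k j) * (2 * pi * t j))"
      by (simp only: cis_power_int cis_sum[OF finite_keys])
    also have "(\<Sum>j\<in>Poly_Mapping.keys k. of_int (Poly_Mapping.lookup k j) * (2 * pi * t j)) =
        (\<Sum>j<d. of_int (Poly_Mapping.lookup k j) * (2 * pi * t j))"
      using sub by (intro sum.mono_neutral_left) (auto simp: in_keys_iff)
    also have "\<dots> = 2 * pi * (\<Sum>j<d. of_int (Poly_Mapping.lookup k j) * t j)"
      unfolding sum_distrib_left by (intro sum.cong) auto
    finally show ?thesis .
  qed
  then have "(\<lambda>t. laurent_eval P (\<lambda>j. cis (2 * pi * t j))) =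
    (\<lambda>t. \<Sum>k\<in>Poly_Mapping.keys P. Poly_Mapping.lookup P k *
      cis (2 * pi * (\<Sum>j<d. of_int (Poly_Mapping.lookup k j) * t j)))"
    unfolding laurent_eval_def by (intro ext sum.cong) auto
  also have "\<dots> \<in> trigpoly d"
    by (intro trigpoly_sum trigpoly.monom) auto
  finally show ?thesis .
qed

lemma common_denominator:
  fixes Q :: "rat set"
  assumes "finite Q"
  shows "\<exists>N>0. \<forall>q\<in>Q. \<exists>z. of_int N * q = of_int z"
  using assms
proof induction
  case (insert q Q)
  then obtain N where N: "N > 0" "\<forall>q\<in>Q. \<exists>z. of_int N * q = of_int z" by blast
  obtain a b where ab: "q = of_int a / of_int b" "b > 0"
    by (metis Fract_of_int_quotient Rat_cases)
  have "\<exists>z. of_int (N * b) * x = of_int z" if "x \<in> insert q Q" for x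
  proof (cases "x = q")
    case True
    then have "of_int (N * b) * x = of_int (N * a)" using ab by simp
    then show ?thesis ..
  next
    case False
    then have "x \<in> Q" using that by simp
    from bspec[OF N(2) this] obtain z where z: "of_int N * x = of_int z" ..
    have "of_int (N * b) * x = of_int b * (of_int N * x)" by simp
    also have "\<dots> = of_int (b * z)" unfolding z by simp
    finally show ?thesis ..
  qed
  moreover have "N * b > 0" using N(1) ab(2) by simp
  ultimately have "N * b > 0 \<and> (\<forall>x\<in>insert q Q. \<exists>z. of_int (N * b) * x = of_int z)"
    by (intro conjI ballI)
  then show ?case ..
qed (auto intro: exI[of _ 1])

text \<open>An independent subset of maximal size spans, since an element outside its span could be
  adjoined.\<close>

lemma rat_rank_basis:
  assumes "finite T"
  obtains S where "S \<subseteq> T" "rat_independent S" "card S = rat_rank T" "T \<subseteq> real_rat.span S"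
proof -
  let ?C = "{card S | S. S \<subseteq> T \<and> rat_independent S}"
  have fin: "finite ?C"
    by (rule finite_subset[of _ "card ` Pow T"]) (use assms in auto)
  moreover have "?C \<noteq> {}" using real_rat.independent_empty by blast
  ultimately have "rat_rank T \<in> ?C" unfolding rat_rank_def by (rule Max_in)
  then obtain S where S: "S \<subseteq> T" "rat_independent S" "card S = rat_rank T" by force
  have "x \<in> real_rat.span S" if "x \<in> T" for x
  proof (rule ccontr)
    assume x: "x \<notin> real_rat.span S"
    then have "x \<notin> S" using real_rat.span_base by blast
    then have "rat_independent (insert x S)" using S x by (simp add: real_rat.independent_insert)
    then have "card (insert x S) \<le> rat_rank T"
      unfolding rat_rank_def using S that by (intro Max_ge fin) blast
    moreover have "card (insert x S) = Suc (card S)"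
      using \<open>x \<notin> S\<close> finite_subset[OF S(1) assms] by simp
    ultimately show False using S by simp
  qed
  then show thesis using that S by blast
qed

lemma rat_independent_divide:
  assumes "rat_independent S" "finite S" "N \<noteq> 0"
  shows "rat_independent ((\<lambda>x. x / of_int N) ` S)"
proof (rule real_rat.independent_if_scalars_zero)
  fix f x assume sum: "(\<Sum>x\<in>(\<lambda>x. x / of_int N) ` S. real_of_rat (f x) * x) = 0"
    and x: "x \<in> (\<lambda>x. x / of_int N) ` S"
  obtain s where s: "s \<in> S" "x = s / of_int N" using x by blast
  have "(\<Sum>s\<in>S. real_of_rat (f (s / of_int N)) * (s / of_int N)) = 0"
    using sum assms(3) by (subst (asm) sum.reindex) (auto simp: inj_on_def)
  moreover have "(\<Sum>s\<in>S. real_of_rat (f (s / of_int N) / of_int N) * s) =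
      (\<Sum>s\<in>S. real_of_rat (f (s / of_int N)) * (s / of_int N))"
    by (simp add: of_rat_divide)
  ultimately have "f (s / of_int N) / of_int N = 0"
    using assms s by (intro real_rat.independentD[where u = "\<lambda>s. f (s / of_int N) / of_int N" and t = S]) auto
  then show "f x = 0" using s assms(3) by simp
qed (use assms in auto)

text \<open>The r j are the elements of a rational basis, chosen among the frequencies, divided by a
  common denominator N of all coordinates; each frequency thus becomes an integer combination, and
  these integers are the exponents.\<close>

lemma laurent_rep_exists:
  fixes \<tau> :: "'i \<Rightarrow> real" and b :: "'i \<Rightarrow> complex"
  assumes fin: "finite I" and inj: "inj_on \<tau> I" and b: "\<And>i. i \<in> I \<Longrightarrow> b i \<noteq> 0"
    and A: "\<And>y. A y = (\<Sum>i\<in>I. b i * cis (2 * pi * \<tau> i * y))"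
  shows "\<exists>P r. laurent_rep (rat_rank (\<tau> ` I)) A r P"
proof -
  define d where "d = rat_rank (\<tau> ` I)"
  obtain S where S: "S \<subseteq> \<tau> ` I" "rat_independent S" "card S = d" "\<tau> ` I \<subseteq> real_rat.span S"
    unfolding d_def using rat_rank_basis[of "\<tau> ` I"] fin by blast
  have finS: "finite S" using S(1) fin finite_subset by blast
  obtain h where h: "bij_betw h {..<d} S"
    using ex_bij_betw_nat_finite[OF finS] S(3) by (auto simp: lessThan_atLeast0)
  have "\<exists>u. \<tau> i = (\<Sum>v\<in>S. real_of_rat (u v) * v)" if "i \<in> I" for i
  proof -
    have "\<tau> i \<in> real_rat.span S" using S(4) that by blast
    then show ?thesis unfolding real_rat.span_finite[OF finS] by blast
  qed
  then obtain u where u: "\<And>i. i \<in> I \<Longrightarrow> \<tau> i = (\<Sum>v\<in>S. real_of_rat (u i v) * v)" by metis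
  have "finite ((\<lambda>(i, v). u i v) ` (I \<times> S))" using fin finS by simp
  from common_denominator[OF this] obtain N where N: "N > 0"
    "\<And>q. q \<in> (\<lambda>(i, v). u i v) ` (I \<times> S) \<Longrightarrow> \<exists>z. of_int N * q = of_int z" by blast
  have "\<exists>z. of_int N * u i v = of_int z" if "i \<in> I" "v \<in> S" for i v
    using that by (intro N(2)) auto
  then obtain z where z: "\<And>i v. i \<in> I \<Longrightarrow> v \<in> S \<Longrightarrow> of_int N * u i v = of_int (z i v)" by metis
  define r where "r = (\<lambda>j. h j / of_int N)"
  have zr: "real_of_rat (u i v) * v = of_int (z i v) * (v / of_int N)" if "i \<in> I" "v \<in> S" for i v
  proof -
    have "real_of_int N * real_of_rat (u i v) = of_int (z i v)"
      using arg_cong[OF z[OF that], of real_of_rat] by (simp add: of_rat_mult)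
    then show ?thesis using N(1) by (simp add: field_simps)
  qed
  have \<tau>r: "\<tau> i = (\<Sum>j<d. of_int (z i (h j)) * r j)" if "i \<in> I" for i
  proof -
    have "\<tau> i = (\<Sum>v\<in>S. of_int (z i v) * (v / of_int N))"
      unfolding u[OF that] by (intro sum.cong refl zr that)
    also have "\<dots> = (\<Sum>j<d. of_int (z i (h j)) * r j)"
      unfolding r_def by (rule sum.reindex_bij_betw[OF h, symmetric])
    finally show ?thesis .
  qed
  define n where "n = (\<lambda>i. Abs_poly_mapping (\<lambda>j. if j < d then z i (h j) else 0))"
  have n: "Poly_Mapping.lookup (n i) = (\<lambda>j. if j < d then z i (h j) else 0)" for i
    unfolding n_def by (rule lookup_Abs_poly_mapping) (rule finite_subset[of _ "{..<d}"], auto)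
  have nkeys: "Poly_Mapping.keys (n i) \<subseteq> {..<d}" for i
    by (auto simp: in_keys_iff n split: if_splits)
  \<comment> \<open>Distinct frequencies have distinct exponent vectors, so no two terms merge and
    the coefficients of P are exactly the b i.\<close>
  have ninj: "inj_on n I"
  proof (rule inj_onI)
    fix i i' assume i: "i \<in> I" "i' \<in> I" "n i = n i'"
    have "z i (h j) = z i' (h j)" if "j < d" for j
      using fun_cong[OF arg_cong[OF i(3), of Poly_Mapping.lookup], of j] that by (simp add: n)
    then have "\<tau> i = \<tau> i'" using i by (simp add: \<tau>r)
    then show "i = i'" using inj i by (auto dest: inj_onD)
  qed
  define P where "P = Abs_poly_mapping (\<lambda>k. if k \<in> n ` I then b (inv_into I n k) else 0)"
  have P: "Poly_Mapping.lookup P = (\<lambda>k. if k \<in> n ` I then b (inv_into I n k) else 0)"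
    unfolding P_def by (rule lookup_Abs_poly_mapping) (rule finite_subset[of _ "n ` I"], use fin in auto)
  have Pn: "Poly_Mapping.lookup P (n i) = b i" if "i \<in> I" for i
    using that ninj by (simp add: P)
  have Pkeys: "Poly_Mapping.keys P = n ` I"
    using b ninj by (auto simp: in_keys_iff P split: if_splits)
  have mon: "(\<Prod>j\<in>Poly_Mapping.keys (n i). cis (2 * pi * r j * y) powi Poly_Mapping.lookup (n i) j) =
      cis (2 * pi * \<tau> i * y)" if "i \<in> I" for i y
  proof -
    have "(\<Prod>j\<in>Poly_Mapping.keys (n i). cis (2 * pi * r j * y) powi Poly_Mapping.lookup (n i) j) =
        cis (\<Sum>j\<in>Poly_Mapping.keys (n i). of_int (Poly_Mapping.lookup (n i) j) * (2 * pi * r j * y))"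
      by (simp only: cis_power_int cis_sum[OF finite_keys])
    also have "(\<Sum>j\<in>Poly_Mapping.keys (n i). of_int (Poly_Mapping.lookup (n i) j) * (2 * pi * r j * y)) =
        (\<Sum>j<d. of_int (Poly_Mapping.lookup (n i) j) * (2 * pi * r j * y))"
      using nkeys by (intro sum.mono_neutral_left) (auto simp: in_keys_iff)
    also have "\<dots> = 2 * pi * \<tau> i * y"
      unfolding \<tau>r[OF that] sum_distrib_left sum_distrib_right by (intro sum.cong) (auto simp: n)
    finally show ?thesis .
  qed
  have "laurent_rep d A r P"
    unfolding laurent_rep_def
  proof (intro conjI allI)
    show "inj_on r {..<d}"
      using bij_betw_imp_inj_on[OF h] N(1) by (auto simp: inj_on_def r_def)
    have "r ` {..<d} = (\<lambda>x. x / of_int N) ` S"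
      using bij_betw_imp_surj_on[OF h] by (auto simp: r_def)
    then show "rat_independent (r ` {..<d})"
      using rat_independent_divide[OF S(2) finS, of N] N(1) by simp
    show "in_vars d P" using nkeys by (auto simp: in_vars_def Pkeys)
    show "A y = laurent_eval P (\<lambda>j. cis (2 * pi * r j * y))" for y
      unfolding laurent_eval_def Pkeys sum.reindex[OF ninj] o_def A
      by (intro sum.cong refl) (simp add: Pn mon)
  qed
  then show ?thesis unfolding d_def by blast
qed

section \<open>Asymptotics from a scaling relation\<close>

text \<open>Iterating the functional equation \<open>n \<approx> ln L / ln \<mu>\<close> times accumulates about \<open>n\<ell>\<close>.\<close>

lemma tendsto_div_ln_of_scaling:
  fixes G I :: "real \<Rightarrow> real"
  assumes \<mu>: "\<mu> > 1" and step: "\<And>L. L > 0 \<Longrightarrow> G (\<mu> * L) = G L + I L"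
    and I: "(I \<longlongrightarrow> l) at_top" and bdd: "\<And>a b. 0 < a \<Longrightarrow> \<exists>C. \<forall>L\<in>{a..b}. \<bar>G L\<bar> \<le> C"
  shows "((\<lambda>L. G L / ln L) \<longlongrightarrow> l / ln \<mu>) at_top"
proof (rule tendstoI)
  fix e :: real assume e: "e > 0"
  have ln\<mu>: "ln \<mu> > 0" using \<mu> by simp
  \<comment> \<open>An error \<epsilon> in each of at most ln x / ln \<mu> steps sums to at most (e
    / 2) ln x.\<close>
  define \<epsilon> where "\<epsilon> = e * ln \<mu> / 2"
  have \<epsilon>: "\<epsilon> > 0" using e ln\<mu> by (simp add: \<epsilon>_def)
  obtain L1 where L1: "\<And>L. L \<ge> L1 \<Longrightarrow> \<bar>I L - l\<bar> < \<epsilon>"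
    using tendstoD[OF I \<epsilon>] unfolding eventually_at_top_linorder dist_real_def by blast
  define L0 where "L0 = max 1 L1"
  have L0: "L0 \<ge> 1" "\<And>L. L \<ge> L0 \<Longrightarrow> \<bar>I L - l\<bar> \<le> \<epsilon>"
    using L1 by (auto simp: L0_def less_imp_le)
  obtain C where C: "\<And>L. L \<in> {L0..\<mu> * L0} \<Longrightarrow> \<bar>G L\<bar> \<le> C"
    using bdd[of L0 "\<mu> * L0"] L0(1) by (meson less_le_trans zero_less_one)
  have iter: "\<bar>G (\<mu> ^ n * L) - real n * l\<bar> \<le> C + real n * \<epsilon>" if L: "L \<in> {L0..\<mu> * L0}" for n L
  proof (induction n)
    case 0
    then show ?case using C[OF L] by simp
  next
    case (Suc n)
    have "1 * L0 \<le> \<mu> ^ n * L"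
      using L L0 \<mu> by (intro mult_mono one_le_power) auto
    then have "G (\<mu> ^ Suc n * L) = G (\<mu> ^ n * L) + I (\<mu> ^ n * L)" "\<bar>I (\<mu> ^ n * L) - l\<bar> \<le> \<epsilon>"
      using step[of "\<mu> ^ n * L"] L0 by (auto simp: mult.assoc)
    then show ?case using Suc by (simp add: algebra_simps)
  qed
  \<comment> \<open>Collects the errors that do not grow with x: the starting value on
    [L0, \<mu> L0], and l ln L / ln \<mu> for L in that interval.\<close>
  define K where "K = \<bar>C\<bar> + \<bar>l\<bar> * ln (\<mu> * L0) / ln \<mu>"
  have "((\<lambda>L. K / ln L) \<longlongrightarrow> 0) at_top"
    by (intro tendsto_divide_0[OF tendsto_const] filterlim_at_top_imp_at_infinity ln_at_top)
  then have "\<forall>\<^sub>F L in at_top. K / ln L < e / 2"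
    using e by (intro order_tendstoD) auto
  then show "\<forall>\<^sub>F L in at_top. dist (G L / ln L) (l / ln \<mu>) < e"
    using eventually_ge_at_top[of L0] eventually_gt_at_top[of 1]
  proof eventually_elim
    case (elim x)
    have lnx: "ln x > 0" using elim by simp
    \<comment> \<open>The number of scalings that leads from the fundamental interval [L0, \<mu> L0]
      to x.\<close>
    define n where "n = nat \<lfloor>log \<mu> (x / L0)\<rfloor>"
    have "log \<mu> (x / L0) \<ge> 0" using elim L0 \<mu> by (simp add: zero_le_log_cancel_iff)
    then have n: "real n \<le> log \<mu> (x / L0)" "log \<mu> (x / L0) < real n + 1"
      by (auto simp: n_def)
    define L where "L = x / \<mu> ^ n"
    have x: "x = \<mu> ^ n * L" using \<mu> by (simp add: L_def)
    have "\<mu> ^ n \<le> x / L0"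
      using n(1) elim L0 \<mu> by (simp add: le_log_iff powr_realpow)
    moreover have "x / L0 < \<mu> ^ Suc n"
      using n(2) elim L0 \<mu> by (simp add: log_less_iff powr_realpow powr_add mult.commute)
    ultimately have L: "L \<in> {L0..\<mu> * L0}"
      using L0 \<mu> by (auto simp: L_def field_simps)
    then have Lpos: "L > 0" using L0 by auto
    have lnx_eq: "ln x = real n * ln \<mu> + ln L"
      using \<mu> Lpos by (simp add: x ln_mult ln_realpow)
    have lnL: "0 \<le> ln L" "ln L \<le> ln (\<mu> * L0)" using L L0 Lpos by auto
    have "l * ln x / ln \<mu> = real n * l + l * ln L / ln \<mu>"
      using ln\<mu> by (simp add: lnx_eq field_simps)
    then have "G x - l * ln x / ln \<mu> = (G x - real n * l) - l * ln L / ln \<mu>"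
      by simp
    then have "\<bar>G x - l * ln x / ln \<mu>\<bar> \<le> \<bar>G x - real n * l\<bar> + \<bar>l * ln L / ln \<mu>\<bar>"
      by (simp only: abs_triangle_ineq4)
    also have "\<dots> \<le> (C + real n * \<epsilon>) + \<bar>l\<bar> * ln (\<mu> * L0) / ln \<mu>"
      using iter[OF L, of n] lnL ln\<mu> unfolding x[symmetric]
      by (intro add_mono) (auto simp: abs_mult intro!: divide_right_mono mult_left_mono)
    also have "\<dots> \<le> K + (ln x / ln \<mu>) * \<epsilon>"
    proof -
      have "real n \<le> ln x / ln \<mu>" using lnx_eq lnL ln\<mu> by (simp add: field_simps)
      then have "real n * \<epsilon> \<le> (ln x / ln \<mu>) * \<epsilon>" using \<epsilon> by (intro mult_right_mono) auto
      then show ?thesis by (simp add: K_def)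
    qed
    also have "(ln x / ln \<mu>) * \<epsilon> = ln x * (e / 2)" using ln\<mu> by (simp add: \<epsilon>_def)
    finally have "\<bar>G x - l * ln x / ln \<mu>\<bar> / ln x \<le> (K + ln x * (e / 2)) / ln x"
      using lnx by (intro divide_right_mono) auto
    also have "\<dots> = K / ln x + e / 2" using lnx by (simp add: field_simps)
    also have "\<dots> < e" using elim(1) by linarith
    also have "\<bar>G x - l * ln x / ln \<mu>\<bar> / ln x = \<bar>G x / ln x - l / ln \<mu>\<bar>"
      using lnx by (subst abs_div_pos) (auto simp: diff_divide_distrib)
    finally show ?case by (simp add: dist_real_def)
  qed
qed

text \<open>As the interval is symmetric, a negative c only reflects it, and |c| alone
  appears.\<close>

lemma set_lint_scale:
  fixes g :: "real \<Rightarrow> real"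
  assumes g: "set_integrable lborel {-L..L} g" and c: "c \<noteq> 0"
  shows "set_integrable lborel {- (\<bar>c\<bar> * L)..\<bar>c\<bar> * L} (\<lambda>y. g (y / c))"
    and "(LINT y:{- (\<bar>c\<bar> * L)..\<bar>c\<bar> * L}|lborel. g (y / c)) = \<bar>c\<bar> * (LINT y:{-L..L}|lborel. g y)"
proof -
  have eq: "indicator {- (\<bar>c\<bar> * L)..\<bar>c\<bar> * L} y *\<^sub>R g (y / c) =
      indicator {-L..L} (0 + 1 / c * y) *\<^sub>R g (0 + 1 / c * y)" for y
  proof -
    have "y \<in> {- (\<bar>c\<bar> * L)..\<bar>c\<bar> * L} \<longleftrightarrow> \<bar>y\<bar> \<le> \<bar>c\<bar> * L" by auto
    also have "\<dots> \<longleftrightarrow> \<bar>y / c\<bar> \<le> L" using c by (simp add: abs_divide pos_divide_le_eq mult.commute)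
    also have "\<dots> \<longleftrightarrow> 0 + 1 / c * y \<in> {-L..L}" by (simp only: abs_le_iff) auto
    finally show ?thesis by (simp add: indicator_def)
  qed
  show "set_integrable lborel {- (\<bar>c\<bar> * L)..\<bar>c\<bar> * L} (\<lambda>y. g (y / c))"
    unfolding set_integrable_def eq
    using lborel_integrable_real_affine[OF g[unfolded set_integrable_def], of "1 / c" 0] c by simp
  have "(LINT y:{-L..L}|lborel. g y) = \<bar>1 / c\<bar> *\<^sub>R (LINT y:{- (\<bar>c\<bar> * L)..\<bar>c\<bar> * L}|lborel. g (y / c))"
    unfolding set_lebesgue_integral_def eq
    by (rule lborel_integral_real_affine) (use c in simp)
  then show "(LINT y:{- (\<bar>c\<bar> * L)..\<bar>c\<bar> * L}|lborel. g (y / c)) = \<bar>c\<bar> * (LINT y:{-L..L}|lborel. g y)"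
    using c by (simp add: abs_divide)
qed

section \<open>Means under the functional equation\<close>

context exp_sum
begin

text \<open>\<open>\<phi>\<close> stands for the Fourier transform; the two parts of
  \<open>\<phi>0\<close> together express continuity at 0 with value 1.\<close>

context
  fixes lam :: real and \<phi> :: "real \<Rightarrow> complex"
  assumes lam: "\<bar>lam\<bar> > 1"
    and \<phi>: "\<And>y. \<phi> y = A (y / lam) * \<phi> (y / lam)"
    and \<phi>0: "(\<phi> \<longlongrightarrow> 1) (at 0)" "\<phi> 0 = 1"
begin

lemma \<phi>_iterate: "\<phi> y = (\<Prod>k<n. A (y / lam ^ Suc k)) * \<phi> (y / lam ^ n)"
proof (induction n)
  case (Suc n)
  then show ?case using \<phi>[of "y / lam ^ n"] by (simp add: mult_ac)
qed simp

lemma \<phi>_scaled_tendsto: "(\<lambda>n. \<phi> (y / lam ^ n)) \<longlonglongrightarrow> 1"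
proof -
  have "isCont \<phi> 0" using \<phi>0 by (simp add: isCont_def)
  moreover have "(\<lambda>n. y / lam ^ n) \<longlonglongrightarrow> 0"
  proof -
    have "(\<lambda>n. y * (1 / lam) ^ n) \<longlonglongrightarrow> y * 0"
      using lam by (intro tendsto_mult_left LIMSEQ_power_zero) (simp add: abs_divide)
    then show ?thesis by (simp add: power_one_over)
  qed
  ultimately show ?thesis using \<phi>0(2) isCont_tendsto_compose by fastforce
qed

text \<open>The remaining factor of the iterated equation tends to 1, so \<open>\<phi>\<close> is a
  pointwise limit of finite products of measurable functions.\<close>

lemma \<phi>_measurable [measurable]: "\<phi> \<in> borel_measurable borel"
proof (rule borel_measurable_LIMSEQ_metric)
  show "(\<lambda>y. \<Prod>k<n. A (y / lam ^ Suc k)) \<in> borel_measurable borel" for n by measurable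
  fix y
  have "\<forall>\<^sub>F n in sequentially. \<phi> (y / lam ^ n) \<noteq> 0"
    using \<phi>_scaled_tendsto by (rule tendsto_imp_eventually_ne) simp
  then have ev: "\<forall>\<^sub>F n in sequentially. \<phi> y / \<phi> (y / lam ^ n) = (\<Prod>k<n. A (y / lam ^ Suc k))"
  proof eventually_elim
    case (elim n)
    show ?case unfolding nonzero_divide_eq_eq[OF elim] by (rule \<phi>_iterate)
  qed
  have "(\<lambda>n. \<phi> y / \<phi> (y / lam ^ n)) \<longlonglongrightarrow> \<phi> y / 1"
    by (intro tendsto_divide tendsto_const \<phi>_scaled_tendsto) simp
  from Lim_transform_eventually[OF this ev] show "(\<lambda>n. \<Prod>k<n. A (y / lam ^ Suc k)) \<longlonglongrightarrow> \<phi> y" by simp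
qed

text \<open>Off countably many null sets all factors A (y / lam^k) are nonzero, and the remaining
  factor is nonzero for large n because it tends to 1.\<close>

lemma AE_\<phi>_nonzero: "AE y in lborel. \<phi> y \<noteq> 0"
proof -
  have "AE y in lborel. \<forall>k. A (y / lam ^ Suc k) \<noteq> 0"
    unfolding AE_all_countable using AE_nonzero_scaled[of "1 / lam ^ Suc k" for k] lam by auto
  then show ?thesis
  proof eventually_elim
    case (elim y)
    have "\<forall>\<^sub>F n in sequentially. \<phi> (y / lam ^ n) \<noteq> 0"
      using \<phi>_scaled_tendsto by (rule tendsto_imp_eventually_ne) simp
    then obtain n where "\<phi> (y / lam ^ n) \<noteq> 0" by (auto simp: eventually_sequentially)
    then show ?case using elim by (subst \<phi>_iterate[of y n]) simp
  qed
qed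

lemma AE_ln_\<phi>:
  "AE y in lborel. ln (cmod (\<phi> y)) = ln (cmod (A (y / lam))) + ln (cmod (\<phi> (y / lam)))"
  using AE_\<phi>_nonzero
proof eventually_elim
  case (elim y)
  then have "A (y / lam) \<noteq> 0" "\<phi> (y / lam) \<noteq> 0" using \<phi>[of y] by auto
  then show ?case by (subst \<phi>[of y]) (simp add: norm_mult ln_mult)
qed

text \<open>The logarithm of the functional equation with y / lam substituted. The integrability
  claim is the step that enlarges the interval by |lam|.\<close>

lemma ln_\<phi>_scale:
  assumes int: "set_integrable lborel {-L..L} (\<lambda>y. ln (cmod (\<phi> y)))"
  shows "set_integrable lborel {- (\<bar>lam\<bar> * L)..\<bar>lam\<bar> * L} (\<lambda>y. ln (cmod (\<phi> y)))"
    and "(LINT y:{- (\<bar>lam\<bar> * L)..\<bar>lam\<bar> * L}|lborel. ln (cmod (\<phi> y))) =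
      \<bar>lam\<bar> * (LINT y:{-L..L}|lborel. ln (cmod (A y))) + \<bar>lam\<bar> * (LINT y:{-L..L}|lborel. ln (cmod (\<phi> y)))"
proof -
  let ?J = "{- (\<bar>lam\<bar> * L)..\<bar>lam\<bar> * L}"
  let ?g = "\<lambda>y. ln (cmod (A (y / lam))) + ln (cmod (\<phi> (y / lam)))"
  have l0: "lam \<noteq> 0" using lam by auto
  note sA = set_lint_scale[OF ln_integrable l0] and s\<phi> = set_lint_scale[OF int l0]
  have ig: "set_integrable lborel ?J ?g"
    by (rule set_integral_add(1)[OF sA(1) s\<phi>(1)])
  have ae: "AE y in lborel. indicator ?J y *\<^sub>R ln (cmod (\<phi> y)) = indicator ?J y *\<^sub>R ?g y"
    using AE_ln_\<phi> by eventually_elim simp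
  have m: "(\<lambda>y. indicator ?J y *\<^sub>R ln (cmod (\<phi> y))) \<in> borel_measurable lborel"
    "(\<lambda>y. indicator ?J y *\<^sub>R ?g y) \<in> borel_measurable lborel" by measurable
  show "set_integrable lborel ?J (\<lambda>y. ln (cmod (\<phi> y)))"
    using ig unfolding set_integrable_def integrable_cong_AE[OF m ae] .
  have "(LINT y:?J|lborel. ln (cmod (\<phi> y))) = (LINT y:?J|lborel. ?g y)"
    unfolding set_lebesgue_integral_def by (rule integral_cong_AE[OF m ae])
  also have "\<dots> = (LINT y:?J|lborel. ln (cmod (A (y / lam)))) + (LINT y:?J|lborel. ln (cmod (\<phi> (y / lam))))"
    by (rule set_integral_add(2)[OF sA(1) s\<phi>(1)])
  finally show "(LINT y:?J|lborel. ln (cmod (\<phi> y))) =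
      \<bar>lam\<bar> * (LINT y:{-L..L}|lborel. ln (cmod (A y))) + \<bar>lam\<bar> * (LINT y:{-L..L}|lborel. ln (cmod (\<phi> y)))"
    by (simp only: sA(2) s\<phi>(2))
qed

text \<open>Near 0 the modulus of \<open>\<phi>\<close> lies in [1/2, 2], so its logarithm is
  bounded; powers of |lam| carry integrability to any interval.\<close>

lemma ln_\<phi>_integrable: "set_integrable lborel {-L..L} (\<lambda>y. ln (cmod (\<phi> y)))"
proof -
  obtain \<delta> where \<delta>: "\<delta> > 0" "\<And>y. \<bar>y\<bar> \<le> \<delta> \<Longrightarrow> dist (\<phi> y) 1 < 1 / 2"
  proof -
    have "\<forall>\<^sub>F y in at 0. dist (\<phi> y) 1 < 1 / 2" using \<phi>0(1) by (rule tendstoD) simp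
    then obtain d where d: "d > 0" "\<And>y. y \<noteq> 0 \<Longrightarrow> dist y 0 < d \<Longrightarrow> dist (\<phi> y) 1 < 1 / 2"
      by (auto simp: eventually_at)
    have "dist (\<phi> y) 1 < 1 / 2" if "\<bar>y\<bar> \<le> d / 2" for y
      using that d \<phi>0(2) by (cases "y = 0") auto
    then show thesis using that[of "d / 2"] d by simp
  qed
  have "\<bar>ln (cmod (\<phi> y))\<bar> \<le> ln 2" if "\<bar>y\<bar> \<le> \<delta>" for y
  proof -
    have "cmod (\<phi> y - 1) < 1 / 2" using \<delta>(2)[OF that] by (simp add: dist_norm)
    then have "1 / 2 \<le> cmod (\<phi> y)" "cmod (\<phi> y) \<le> 2"
      using norm_triangle_ineq2[of 1 "1 - \<phi> y"] norm_triangle_sub[of "\<phi> y" 1]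
      by (auto simp: norm_minus_commute)
    then have "ln (1 / 2) \<le> ln (cmod (\<phi> y))" "ln (cmod (\<phi> y)) \<le> ln 2"
      by (auto intro!: ln_mono)
    then show ?thesis by (simp add: ln_div abs_le_iff)
  qed
  then have base: "set_integrable lborel {-\<delta>..\<delta>} (\<lambda>y. ln (cmod (\<phi> y)))"
    unfolding set_integrable_def
    by (intro integrableI_bounded_set[where A = "{-\<delta>..\<delta>}" and B = "ln 2"] AE_I2)
      (auto simp: indicator_def emeasure_lborel_Icc_eq)
  have "set_integrable lborel {- (\<bar>lam\<bar> ^ n * \<delta>)..\<bar>lam\<bar> ^ n * \<delta>} (\<lambda>y. ln (cmod (\<phi> y)))" for n
  proof (induction n)
    case (Suc n)
    from ln_\<phi>_scale(1)[OF this] show ?case by (simp add: mult.assoc)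
  qed (use base in simp)
  note int = this
  obtain n where "L / \<delta> < \<bar>lam\<bar> ^ n"
    using real_arch_pow[OF lam] by blast
  then have "L \<le> \<bar>lam\<bar> ^ n * \<delta>" using \<delta>(1) by (simp add: field_simps)
  then show ?thesis
    by (intro set_integrable_subset[OF int[of n]]) auto
qed

text \<open>Division by 2 |lam| L cancels the factor |lam| from the substitution, leaving the
  additive relation G (|lam| L) = G L + I L.\<close>

lemma ln_\<phi>_mean:
  assumes "((\<lambda>L. (LINT y:{-L..L}|lborel. ln (cmod (A y))) / (2 * L)) \<longlongrightarrow> l) at_top"
  shows "((\<lambda>L. 1 / (2 * L * ln L) * (LINT y:{-L..L}|lborel. ln (cmod (\<phi> y)))) \<longlongrightarrow> l / ln \<bar>lam\<bar>) at_top"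
proof -
  let ?G = "\<lambda>L. (LINT y:{-L..L}|lborel. ln (cmod (\<phi> y))) / (2 * L)"
  have "((\<lambda>L. ?G L / ln L) \<longlongrightarrow> l / ln \<bar>lam\<bar>) at_top"
  proof (rule tendsto_div_ln_of_scaling[OF lam _ assms])
    fix L :: real assume "L > 0"
    then show "?G (\<bar>lam\<bar> * L) = ?G L + (LINT y:{-L..L}|lborel. ln (cmod (A y))) / (2 * L)"
      using lam by (subst ln_\<phi>_scale(2)[OF ln_\<phi>_integrable]) (auto simp: field_simps)
  next
    fix a b :: real assume a: "0 < a"
    \<comment> \<open>One integral over the largest interval bounds all G L with L in [a, b], up to
      the factor 1 / (2 a).\<close>
    define K where "K = (LINT y:{-b..b}|lborel. \<bar>ln (cmod (\<phi> y))\<bar>)"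
    have iK: "set_integrable lborel {-b..b} (\<lambda>y. \<bar>ln (cmod (\<phi> y))\<bar>)"
      by (rule set_integrable_abs[OF ln_\<phi>_integrable])
    have "\<bar>?G L\<bar> \<le> K / (2 * a)" if L: "L \<in> {a..b}" for L
    proof -
      have "\<bar>LINT y:{-L..L}|lborel. ln (cmod (\<phi> y))\<bar> \<le> (LINT y:{-L..L}|lborel. \<bar>ln (cmod (\<phi> y))\<bar>)"
        using set_integral_norm_bound[OF ln_\<phi>_integrable[of L]] by simp
      also have "\<dots> \<le> K"
        unfolding K_def set_lebesgue_integral_def
        using set_integrable_abs[OF ln_\<phi>_integrable[of L]] iK L
        unfolding set_integrable_def
        by (intro integral_mono) (auto simp: indicator_def)
      finally have le: "\<bar>LINT y:{-L..L}|lborel. ln (cmod (\<phi> y))\<bar> \<le> K" .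
      moreover have "0 \<le> K" using le abs_ge_zero order.trans by blast
      ultimately show ?thesis
        using L a by (auto simp: abs_divide intro!: frac_le)
    qed
    then show "\<exists>C. \<forall>L\<in>{a..b}. \<bar>?G L\<bar> \<le> C" by blast
  qed
  then show ?thesis by (simp add: field_simps)
qed

end

end

theorem theorem2:
  fixes lam :: real and m :: nat and a :: "nat \<Rightarrow> complex" and \<tau> :: "nat \<Rightarrow> real"
    and f :: "(real \<Rightarrow> complex) \<Rightarrow> complex"
  assumes "lam \<notin> {-1..1}"
    and "m \<ge> 1"
    and "\<And>j. j \<in> {1..m} \<Longrightarrow> a j \<noteq> 0"
    and "(\<Sum>j=1..m. a j) = of_real \<bar>lam\<bar>"
    and "strict_mono_on {1..m} \<tau>"
    and "compactly_supported_distribution f"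
    and "refinable lam m a \<tau> f"
    and "dist_fourier f 0 = 1"
  shows "((\<lambda>L. 1 / (2 * L * ln L) *
            (LINT y:{-L..L}|lborel. ln (cmod (dist_fourier f y))))
          \<longlongrightarrow> - rho lam m a \<tau>) at_top"
proof -
  let ?b = "\<lambda>j. a j / of_real \<bar>lam\<bar>"
  have lam: "\<bar>lam\<bar> > 1" using assms(1) by auto
  have inj\<tau>: "inj_on \<tau> {1..m}" using assms(5) by (rule strict_mono_on_imp_inj_on)
  interpret exp_sum "{1..m}" ?b "\<lambda>j. 2 * pi * \<tau> j"
  proof
    show "{1..m} \<noteq> {}" using assms(2) by simp
    show "inj_on (\<lambda>j. 2 * pi * \<tau> j) {1..m}"
      by (rule inj_onI) (use inj_onD[OF inj\<tau>] in simp)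
    show "?b j \<noteq> 0" if "j \<in> {1..m}" for j
      using assms(3)[OF that] lam by auto
  qed simp
  interpret distrib f
    using assms(6) by unfold_locales (simp add: compactly_supported_distribution_def)
  have supp: "compact (dist_supp f)" using assms(6) by (simp add: compactly_supported_distribution_def)
  have A_mask: "A y = mask lam m a \<tau> y" for y
    unfolding D_def mask_def by (simp add: sum_divide_distrib)
  have A_sum: "mask lam m a \<tau> y = (\<Sum>j\<in>{1..m}. ?b j * cis (2 * pi * \<tau> j * y))" for y
    by (simp add: mask_def sum_divide_distrib)
  define d where "d = rat_rank (\<tau> ` {1..m})"
  \<comment> \<open>Literally the choice made in \<open>exp_sum_mahler\<close>; the existence of a
    representation turns it into one.\<close>
  define P where "P = (SOME P. \<exists>r. laurent_rep d (mask lam m a \<tau>) r P)"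
  have "\<exists>P r. laurent_rep d (mask lam m a \<tau>) r P"
    unfolding d_def using laurent_rep_exists[of "{1..m}" \<tau> ?b, OF _ inj\<tau> _ A_sum] assms(3) lam by auto
  then have "\<exists>r. laurent_rep d (mask lam m a \<tau>) r P"
    unfolding P_def by (rule someI_ex)
  then obtain r where r: "laurent_rep d (mask lam m a \<tau>) r P" ..
  let ?F = "\<lambda>t. laurent_eval P (\<lambda>j. cis (2 * pi * t j))"
  have "((\<lambda>L. (LINT y:{-L..L}|lborel. ln (cmod (A y))) / (2 * L)) \<longlongrightarrow> (LINT t|torus d. ln (cmod (?F t)))) at_top"
  proof (rule mean_ln)
    show "?F \<in> trigpoly d" using r by (intro laurent_eval_trigpoly) (simp add: laurent_rep_def)
    show "rat_independent (r ` {..<d})" "inj_on r {..<d}" using r by (simp_all add: laurent_rep_def)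
    show "A y = laurent_eval P (\<lambda>j. cis (2 * pi * (r j * y)))" for y
      using r unfolding A_mask by (simp add: laurent_rep_def mult.assoc)
  qed
  then have mean: "((\<lambda>L. (LINT y:{-L..L}|lborel. ln (cmod (A y))) / (2 * L)) \<longlongrightarrow>
      ln (exp_sum_mahler (\<tau> ` {1..m}) (mask lam m a \<tau>))) at_top"
    by (simp add: exp_sum_mahler_def Let_def mahler_measure_def set_lint_torus d_def P_def)
  have "((\<lambda>L. 1 / (2 * L * ln L) * (LINT y:{-L..L}|lborel. ln (cmod (dist_fourier f y)))) \<longlongrightarrow>
      ln (exp_sum_mahler (\<tau> ` {1..m}) (mask lam m a \<tau>)) / ln \<bar>lam\<bar>) at_top"
  proof (rule ln_\<phi>_mean[of lam "dist_fourier f", OF lam _ _ assms(8) mean])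
    show "dist_fourier f y = A (y / lam) * dist_fourier f (y / lam)" for y
      unfolding A_mask by (rule dist_fourier_refinable[OF supp assms(7) lam])
    show "(dist_fourier f \<longlongrightarrow> 1) (at 0)"
      using dist_fourier_tendsto[OF supp] assms(8) by simp
  qed
  then show ?thesis by (simp add: rho_def)
qed

end
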